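(* Let $M$ and $N$ be smooth closed manifolds of dimensions at least $1$, and fix Borel probability measures $\mu$ on $M$ and $\nu$ on $N$. For each $k\in\{0,1,2,\dots\}\cup\{\infty\}$ there exists a residual set $\mathcal C\subset C^k(M\times N;\mathbb{R})$ such that for every $c\in\mathcal C$ there is a unique optimal plan between $\mu$ and $\nu$, i.e. a unique minimizer of $\gamma\mapsto\int_{M\times N}c\,d\gamma$ over $\gamma\in\Pi(\mu,\nu)$.
   Context: A closed manifold is a compact manifold without boundary. $\Pi(\mu,\nu)$ is the set of non-negative Borel measures on $M\times N$ with marginals $\mu$ and $\nu$. $C^k(M\times N;\mathbb{R})$ carries the usual $C^k$ topology. A residual set is a countable intersection of open dense sets. *)

theory Defs
  imports "HOL-Probability.Probability"
begin

text \<open>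
  At a point with a neighbourhood on which \<^term>\<open>f\<close> is sufficiently often differentiable,
  \<open>iter_deriv [v1, ..., vn] f x\<close> is the value of the \<open>n\<close>-th derivative of \<open>f\<close> at \<open>x\<close> on
  \<open>(v1, ..., vn)\<close>. It depends only on the germ of \<open>f\<close> at \<open>x\<close>.
\<close>

primrec iter_deriv ::
  "'e::real_normed_vector list \<Rightarrow> ('e \<Rightarrow> 'f::real_normed_vector) \<Rightarrow> 'e \<Rightarrow> 'f" where
  "iter_deriv [] f = f"
| "iter_deriv (v # vs) f = iter_deriv vs (\<lambda>x. frechet_derivative f (at x) v)"

text \<open>
  The class \<open>C\<^sup>k\<close> on a set \<^term>\<open>S\<close>, meant for open \<^term>\<open>S\<close> in a finite-dimensional space:
  all iterated derivatives of order less than \<open>k\<close> are differentiable and those of order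
  at most \<open>k\<close> are continuous.
\<close>

definition Ck_on ::
  "enat \<Rightarrow> ('e::euclidean_space \<Rightarrow> 'f::real_normed_vector) \<Rightarrow> 'e set \<Rightarrow> bool" where
  "Ck_on k f S \<longleftrightarrow>
     (\<forall>vs. enat (length vs) < k \<longrightarrow> (\<forall>x\<in>S. iter_deriv vs f differentiable (at x))) \<and>
     (\<forall>vs. enat (length vs) \<le> k \<longrightarrow> continuous_on S (iter_deriv vs f))"

text \<open>
  A manifold is modelled as a type with its topology together with a smooth atlas.  A chart is a
  domain with a coordinate map; the values of the coordinate map outside of the domain are
  irrelevant, and \<^term>\<open>inv_into U \<phi>\<close> is the inverse \<open>\<phi> ` U \<rightarrow> U\<close>.
\<close>

type_synonym ('a, 'e) chart = "'a set \<times> ('a \<Rightarrow> 'e)"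

definition is_chart :: "('a::topological_space, 'e::euclidean_space) chart \<Rightarrow> bool" where
  "is_chart = (\<lambda>(U, \<phi>). open U \<and> open (\<phi> ` U) \<and> homeomorphism U (\<phi> ` U) \<phi> (inv_into U \<phi>))"

text \<open>The condition for a pair of charts in the other order gives the inverse transition map.\<close>

definition smooth_transition ::
  "('a, 'e::euclidean_space) chart \<Rightarrow> ('a, 'e) chart \<Rightarrow> bool" where
  "smooth_transition =
     (\<lambda>(U, \<phi>) (V, \<psi>). Ck_on \<infinity> (\<lambda>x. \<psi> (inv_into U \<phi> x)) (\<phi> ` (U \<inter> V)))"

definition smooth_atlas :: "('a::topological_space, 'e::euclidean_space) chart set \<Rightarrow> bool" where
  "smooth_atlas A \<longleftrightarrow>
     (\<forall>C\<in>A. is_chart C) \<and> (\<Union>C\<in>A. fst C) = UNIV \<and>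
     (\<forall>C\<in>A. \<forall>D\<in>A. smooth_transition C D)"

text \<open>
  Charts take values in an open subset of \<^typ>\<open>'e\<close>, so there is no boundary and the dimension
  is \<open>DIM('e)\<close>, which is at least one for every type of class \<^class>\<open>euclidean_space\<close>.
\<close>

definition smooth_closed_manifold ::
  "('a::{t2_space, second_countable_topology}, 'e::euclidean_space) chart set \<Rightarrow> bool" where
  "smooth_closed_manifold A \<longleftrightarrow> compact (UNIV :: 'a set) \<and> smooth_atlas A"

definition prod_atlas ::
  "('a, 'e) chart set \<Rightarrow> ('b, 'f) chart set \<Rightarrow> ('a \<times> 'b, 'e \<times> 'f) chart set" where
  "prod_atlas A B = {(U \<times> V, map_prod \<phi> \<psi>) | U \<phi> V \<psi>. (U, \<phi>) \<in> A \<and> (V, \<psi>) \<in> B}"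

definition Ck_functions ::
  "('a, 'e::euclidean_space) chart set \<Rightarrow> enat \<Rightarrow> ('a \<Rightarrow> real) set" where
  "Ck_functions A k =
     {f. \<forall>(U, \<phi>)\<in>A. Ck_on k (\<lambda>x. f (inv_into U \<phi> x)) (\<phi> ` U)}"

text \<open>
  The \<open>C\<^sup>k\<close> topology is generated by the sets of functions whose iterated derivative
  \<^term>\<open>iter_deriv vs\<close>, of order \<open>length vs \<le> k\<close> in a chart, is uniformly close to that of a given
  function on a compact subset of the image of the chart.  For \<open>k = \<infinity>\<close> this means
  uniform closeness, on compact sets in charts, of finitely many derivatives at a time.
\<close>

definition Ck_nbhd ::
  "('a, 'e::euclidean_space) chart set \<Rightarrow> enat \<Rightarrow> ('a, 'e) chart \<Rightarrow> 'e set \<Rightarrow> 'e list \<Rightarrow> real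
     \<Rightarrow> ('a \<Rightarrow> real) \<Rightarrow> ('a \<Rightarrow> real) set" where
  "Ck_nbhd A k = (\<lambda>(U, \<phi>) K vs \<epsilon> f.
     {g \<in> Ck_functions A k. \<forall>x\<in>K.
        \<bar>iter_deriv vs (\<lambda>y. g (inv_into U \<phi> y)) x - iter_deriv vs (\<lambda>y. f (inv_into U \<phi> y)) x\<bar> < \<epsilon>})"

definition Ck_topology ::
  "('a, 'e::euclidean_space) chart set \<Rightarrow> enat \<Rightarrow> ('a \<Rightarrow> real) topology" where
  "Ck_topology A k = topology_generated_by
     {Ck_nbhd A k (U, \<phi>) K vs \<epsilon> f | U \<phi> K vs \<epsilon> f.
        (U, \<phi>) \<in> A \<and> compact K \<and> K \<subseteq> \<phi> ` U \<and> enat (length vs) \<le> k \<and> \<epsilon> > 0 \<and>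
        f \<in> Ck_functions A k}"

lemma topspace_Ck_topology:
  assumes "A \<noteq> {}"
  shows "topspace (Ck_topology A k) = Ck_functions A k"
proof
  show "topspace (Ck_topology A k) \<subseteq> Ck_functions A k"
    unfolding Ck_topology_def topology_generated_by_topspace Ck_nbhd_def by auto
next
  obtain U \<phi> where "(U, \<phi>) \<in> A" using assms by auto
  show "Ck_functions A k \<subseteq> topspace (Ck_topology A k)"
  proof
    fix f assume f: "f \<in> Ck_functions A k"
    have "f \<in> Ck_nbhd A k (U, \<phi>) {} [] 1 f" using f by (simp add: Ck_nbhd_def)
    moreover have "compact ({} :: 'b set)" "{} \<subseteq> \<phi> ` U" "enat (length ([] :: 'b list)) \<le> k"
      "(1::real) > 0" by (auto simp: zero_enat_def[symmetric])
    ultimately show "f \<in> topspace (Ck_topology A k)"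
      unfolding Ck_topology_def topology_generated_by_topspace
      using \<open>(U, \<phi>) \<in> A\<close> f by blast
  qed
qed

text \<open>
  The intersection with the whole space only matters for the empty family, and it makes a
  residual set a subset of the space.
\<close>

definition residual_in :: "'x topology \<Rightarrow> 'x set \<Rightarrow> bool" where
  "residual_in X S \<longleftrightarrow>
     (\<exists>\<U>. countable \<U> \<and> (\<forall>U\<in>\<U>. openin X U \<and> X closure_of U = topspace X) \<and>
          S = topspace X \<inter> \<Inter>\<U>)"

definition transport_plans ::
  "'a::topological_space measure \<Rightarrow> 'b::topological_space measure \<Rightarrow> ('a \<times> 'b) measure set" where
  "transport_plans \<mu> \<nu> =
     {\<gamma>. sets \<gamma> = sets borel \<and> distr \<gamma> borel fst = \<mu> \<and> distr \<gamma> borel snd = \<nu>}"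

definition optimal_plan ::
  "('a \<times> 'b \<Rightarrow> real) \<Rightarrow> 'a::topological_space measure \<Rightarrow> 'b::topological_space measure
     \<Rightarrow> ('a \<times> 'b) measure \<Rightarrow> bool" where
  "optimal_plan c \<mu> \<nu> \<gamma> \<longleftrightarrow>
     \<gamma> \<in> transport_plans \<mu> \<nu> \<and>
     (\<forall>\<gamma>'\<in>transport_plans \<mu> \<nu>. (\<integral>z. c z \<partial>\<gamma>) \<le> (\<integral>z. c z \<partial>\<gamma>'))"

end

theory Submission
  imports Defs
begin

text \<open>
  Uniqueness for a generic cost rests on convexity along lines. Fix a cost \<open>c\<close> and a continuous
  function \<open>f\<close>. The optimal value for the cost \<open>c + t f\<close> is an infimum of affine functions of \<open>t\<close>,
  hence concave, and the integral of \<open>f\<close> over an optimal plan is one of its slopes at \<open>t\<close>.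
  As slopes decrease in \<open>t\<close> and are bounded by \<open>sup \<bar>f\<bar>\<close>, they cannot jump by \<open>r > 0\<close> at
  too many places. So for some arbitrarily small \<open>t\<close> all nearly optimal plans for \<open>c + t f\<close> give
  integrals of \<open>f\<close> that differ by less than \<open>r\<close> (\<open>small_spread_on_line\<close>). The costs with this
  property form a set that is dense, because \<open>c + t f\<close> tends to \<open>c\<close> in the \<open>C\<^sup>k\<close> topology for
  \<open>f\<close> of class \<open>C\<^sup>k\<close> (\<open>Ck_topology_line\<close>), and open, because near-optimality is stable under
  uniformly small changes of the cost (\<open>spread_less_stable\<close>). That the property speaks of nearly
  optimal plans, not just of optimal ones, is what reduces openness to this direct estimate.

  Let \<open>f\<close> run through a countable family of smooth functions on the product and \<open>r\<close> through
  \<open>1 / n\<close>. For a cost in the resulting residual set, two optimal plans integrate every member of the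
  family to the same value. It remains to choose a family whose integrals determine a measure
  (\<open>countable_smooth_separating_family\<close>). The functions \<open>exp (- 1 / (n t))\<close>, extended by zero to
  \<open>t \<le> 0\<close>, give smooth functions in charts that increase to the indicators of chart balls; products
  of these exhaust rectangles and their finite intersections. Second countability leaves countably
  many sets, which form an intersection-stable generator of the Borel sets.

  Existence of an optimal plan holds for every continuous cost (\<open>optimal_plan_exists\<close>). By
  Tychonoff's theorem the values of a minimizing sequence of plans on all Borel sets have a common
  cluster point, a finitely additive set function with the prescribed marginals. The marginals are
  regular and the product is compact, which makes it countably additive on an algebra containing
  all Borel rectangles; Caratheodory's theorem extends it to a plan, and a continuous cost, being a
  uniform limit of step functions on rectangles, has the limit of its integrals as integral.
\<close>

section \<open>Calculus of the class \<open>C\<^sup>k\<close>\<close>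

lemma Ck_on_0: "Ck_on (enat 0) f S \<longleftrightarrow> continuous_on S f"
  by (auto simp: Ck_on_def zero_enat_def)

text \<open>
  Splitting off the first direction makes induction on the order of differentiability possible;
  closure under sums, products and compositions is proved that way.
\<close>

lemma Ck_on_Suc:
  "Ck_on (enat (Suc n)) f S \<longleftrightarrow>
     (\<forall>x\<in>S. f differentiable (at x)) \<and>
     (\<forall>v. Ck_on (enat n) (\<lambda>x. frechet_derivative f (at x) v) S)"
proof (intro iffI conjI allI ballI)
  assume f: "Ck_on (enat (Suc n)) f S"
  show "f differentiable at x" if "x \<in> S" for x
    using f that unfolding Ck_on_def by (auto dest!: spec[of _ "[]"] simp: zero_enat_def[symmetric])
  show "Ck_on (enat n) (\<lambda>x. frechet_derivative f (at x) v) S" for v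
    using f unfolding Ck_on_def by (force dest: spec[of _ "v # _"])
next
  assume f: "(\<forall>x\<in>S. f differentiable (at x)) \<and>
    (\<forall>v. Ck_on (enat n) (\<lambda>x. frechet_derivative f (at x) v) S)"
  have "continuous_on S f"
    using f by (auto intro!: continuous_at_imp_continuous_on differentiable_imp_continuous_within)
  then show "Ck_on (enat (Suc n)) f S"
    using f unfolding Ck_on_def
    by (intro conjI allI impI; rename_tac vs; case_tac vs) auto
qed

lemma Ck_on_iff_finite_order: "Ck_on k f S \<longleftrightarrow> (\<forall>n. enat n \<le> k \<longrightarrow> Ck_on (enat n) f S)"
proof (intro iffI allI impI)
  fix n assume "Ck_on k f S" "enat n \<le> k"
  then show "Ck_on (enat n) f S"
    unfolding Ck_on_def by (meson dual_order.trans order_less_le_trans)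
next
  assume *: "\<forall>n. enat n \<le> k \<longrightarrow> Ck_on (enat n) f S"
  show "Ck_on k f S" unfolding Ck_on_def
  proof (intro conjI allI impI ballI)
    fix vs :: "'a list" and x assume "enat (length vs) < k" "x \<in> S"
    then show "iter_deriv vs f differentiable at x"
      using *[rule_format, of "Suc (length vs)"] unfolding Ck_on_def
      by (simp add: Suc_ile_eq)
  next
    fix vs :: "'a list" assume "enat (length vs) \<le> k"
    then show "continuous_on S (iter_deriv vs f)"
      using *[rule_format, of "length vs"] unfolding Ck_on_def by simp
  qed
qed

lemma Ck_on_infty_iff: "Ck_on \<infinity> f S \<longleftrightarrow> (\<forall>n. Ck_on (enat n) f S)"
  by (subst Ck_on_iff_finite_order) simp

lemma Ck_on_mono: "Ck_on k f S \<Longrightarrow> j \<le> k \<Longrightarrow> Ck_on j f S"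
  unfolding Ck_on_iff_finite_order[of k] Ck_on_iff_finite_order[of j] using order_trans by blast

lemma Ck_on_Un:
  assumes "open S" "open T" "Ck_on k f S" "Ck_on k f T"
  shows "Ck_on k f (S \<union> T)"
  using assms unfolding Ck_on_def by (auto intro: continuous_on_open_Un)

lemma Ck_on_Suc_imp: "Ck_on (enat (Suc n)) f S \<Longrightarrow> Ck_on (enat n) f S"
  by (erule Ck_on_mono) simp

lemma Ck_on_imp_continuous_on: "Ck_on k f S \<Longrightarrow> continuous_on S f"
  unfolding Ck_on_def by (auto dest!: spec[of _ "[]"] simp: zero_enat_def[symmetric])

lemma frechet_derivative_cong_open:
  assumes "open S" "x \<in> S" "\<And>y. y \<in> S \<Longrightarrow> f y = g y"
  shows "frechet_derivative f (at x) = frechet_derivative g (at x)"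
proof -
  have "(f has_derivative D) (at x) \<longleftrightarrow> (g has_derivative D) (at x)" for D
    using assms has_derivative_transform_within_open[of f D x UNIV S g]
      has_derivative_transform_within_open[of g D x UNIV S f] by auto
  then show ?thesis unfolding frechet_derivative_def by simp
qed

lemma differentiable_cong_open:
  assumes "open S" "x \<in> S" "\<And>y. y \<in> S \<Longrightarrow> f y = g y" "f differentiable (at x)"
  shows "g differentiable (at x)"
  using assms has_derivative_transform_within_open[of f _ x UNIV S g]
  unfolding differentiable_def by blast

text \<open>
  Iterated derivatives depend on germs only, so on an open set functions may be exchanged for equal
  ones.
\<close>

lemma Ck_on_cong:
  assumes "open S" "\<And>y. y \<in> S \<Longrightarrow> f y = g y" "Ck_on k f S"
  shows "Ck_on k g S"
proof -
  have "Ck_on (enat n) f S \<Longrightarrow> (\<And>y. y \<in> S \<Longrightarrow> f y = g y) \<Longrightarrow> Ck_on (enat n) g S"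
    for n and f g :: "'a \<Rightarrow> 'b"
  proof (induction n arbitrary: f g)
    case 0
    then show ?case by (simp add: Ck_on_0 cong: continuous_on_cong)
  next
    case (Suc n)
    have "Ck_on (enat n) (\<lambda>x. frechet_derivative g (at x) v) S" for v
    proof (rule Suc.IH)
      show "Ck_on (enat n) (\<lambda>x. frechet_derivative f (at x) v) S"
        using Suc.prems(1) unfolding Ck_on_Suc by blast
      show "frechet_derivative f (at y) v = frechet_derivative g (at y) v" if "y \<in> S" for y
        by (rule fun_cong[OF frechet_derivative_cong_open[OF assms(1) that]]) (rule Suc.prems(2))
    qed
    moreover have "g differentiable at x" if "x \<in> S" for x
      by (rule differentiable_cong_open[OF assms(1) that, where f = f])
        (use Suc.prems that in \<open>auto simp: Ck_on_Suc\<close>)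
    ultimately show ?case unfolding Ck_on_Suc by blast
  qed
  then have "Ck_on (enat n) f S \<Longrightarrow> Ck_on (enat n) g S" for n
    using assms(2) by blast
  then show ?thesis
    using assms(3) unfolding Ck_on_iff_finite_order[of k] by blast
qed

lemma Ck_on_SucI:
  assumes "open S" "\<And>x. x \<in> S \<Longrightarrow> (f has_derivative D x) (at x)"
    "\<And>v. Ck_on (enat n) (\<lambda>x. D x v) S"
  shows "Ck_on (enat (Suc n)) f S"
proof -
  have "Ck_on (enat n) (\<lambda>x. frechet_derivative f (at x) v) S" for v
    by (rule Ck_on_cong[OF assms(1) _ assms(3)[of v]])
      (simp add: frechet_derivative_at[OF assms(2), symmetric])
  then show ?thesis using assms(2) unfolding Ck_on_Suc differentiable_def by blast
qed

lemma Ck_on_SucD: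
  assumes "Ck_on (enat (Suc n)) f S" "x \<in> S"
  shows "(f has_derivative frechet_derivative f (at x)) (at x)"
  using assms by (auto simp: Ck_on_Suc frechet_derivative_works)

lemma Ck_on_const: "open S \<Longrightarrow> Ck_on (enat n) (\<lambda>x. c) S"
proof (induction n arbitrary: c)
  case 0
  then show ?case by (simp add: Ck_on_0)
next
  case (Suc n)
  show ?case
    by (rule Ck_on_SucI[where D="\<lambda>x v. 0"]) (use Suc in auto)
qed

lemma Ck_on_bounded_linear:
  assumes "open S" "bounded_linear f"
  shows "Ck_on (enat n) f S"
proof (cases n)
  case 0
  then show ?thesis using assms(2)
    by (simp add: Ck_on_0 linear_continuous_on)
next
  case (Suc m)
  show ?thesis unfolding Suc
    by (rule Ck_on_SucI[where D="\<lambda>x. f"])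
      (use assms in \<open>auto intro: Ck_on_const bounded_linear_imp_has_derivative\<close>)
qed

lemma Ck_on_linear_comp:
  assumes "open S" "bounded_linear h" "Ck_on (enat n) f S"
  shows "Ck_on (enat n) (\<lambda>x. h (f x)) S"
  using assms(3)
proof (induction n arbitrary: f)
  case 0
  then show ?case using bounded_linear.continuous_on[OF assms(2)] by (simp add: Ck_on_0)
next
  case (Suc n)
  show ?case
    by (rule Ck_on_SucI[OF assms(1) bounded_linear.has_derivative[OF assms(2) Ck_on_SucD[OF Suc.prems]]])
      (use Suc in \<open>auto simp: Ck_on_Suc\<close>)
qed

lemma Ck_on_add:
  assumes "open S" "Ck_on (enat n) f S" "Ck_on (enat n) g S"
  shows "Ck_on (enat n) (\<lambda>x. f x + g x) S"
  using assms(2,3)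
proof (induction n arbitrary: f g)
  case 0
  then show ?case by (simp add: Ck_on_0 continuous_on_add)
next
  case (Suc n)
  show ?case
    by (rule Ck_on_SucI[OF assms(1)], rule has_derivative_add)
      (use Suc in \<open>auto intro: Ck_on_SucD simp: Ck_on_Suc\<close>)
qed

lemma Ck_on_sum:
  assumes "open S" "finite I" "\<And>i. i \<in> I \<Longrightarrow> Ck_on (enat n) (f i) S"
  shows "Ck_on (enat n) (\<lambda>x. \<Sum>i\<in>I. f i x) S"
  using assms(2,3)
proof (induction I)
  case empty
  then show ?case using Ck_on_const[OF assms(1)] by simp
next
  case (insert i I)
  then show ?case using Ck_on_add[OF assms(1), of n "f i"] by simp
qed

lemma Ck_on_mult:
  fixes f g :: "'e::euclidean_space \<Rightarrow> real"
  assumes "open S" "Ck_on (enat n) f S" "Ck_on (enat n) g S"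
  shows "Ck_on (enat n) (\<lambda>x. f x * g x) S"
  using assms(2,3)
proof (induction n arbitrary: f g)
  case 0
  then show ?case by (simp add: Ck_on_0 continuous_on_mult)
next
  case (Suc n)
  show ?case
  proof (rule Ck_on_SucI[OF assms(1)], rule has_derivative_mult)
    show "Ck_on (enat n) (\<lambda>x. f x * frechet_derivative g (at x) v +
      frechet_derivative f (at x) v * g x) S" for v
      using Suc.prems Suc.prems[THEN Ck_on_Suc_imp]
      by (intro Ck_on_add[OF assms(1)] Suc.IH) (simp_all add: Ck_on_Suc)
  qed (use Suc in \<open>auto intro: Ck_on_SucD\<close>)
qed

text \<open>
  Expanding the outer derivative in coordinates turns the derivative of the composition into a finite
  sum of products of functions that are \<open>n\<close> times differentiable, by assumption or by induction.
\<close>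

lemma Ck_on_compose:
  fixes f :: "'e::euclidean_space \<Rightarrow> 'f::euclidean_space" and g :: "'f \<Rightarrow> real"
  assumes "open S" "open T" "f ` S \<subseteq> T" "Ck_on (enat n) f S" "Ck_on (enat n) g T"
  shows "Ck_on (enat n) (\<lambda>x. g (f x)) S"
  using assms(4,5)
proof (induction n arbitrary: g)
  case 0
  then show ?case using continuous_on_compose2[OF _ _ assms(3), of g] by (simp add: Ck_on_0)
next
  case (Suc n)
  note f = Suc.prems(1) and g = Suc.prems(2)
  have fT: "f x \<in> T" if "x \<in> S" for x using assms(3) that by auto
  have D: "frechet_derivative g (at (f x)) (frechet_derivative f (at x) v) =
     (\<Sum>b\<in>Basis. (frechet_derivative f (at x) v \<bullet> b) * frechet_derivative g (at (f x)) b)"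
    if x: "x \<in> S" for x v
  proof -
    have lin: "linear (frechet_derivative g (at (f x)))"
      using Ck_on_SucD[OF g fT[OF x]] has_derivative_linear by blast
    have "frechet_derivative g (at (f x)) (frechet_derivative f (at x) v) =
      frechet_derivative g (at (f x)) (\<Sum>b\<in>Basis. (frechet_derivative f (at x) v \<bullet> b) *\<^sub>R b)"
      by (simp add: euclidean_representation)
    also have "\<dots> = (\<Sum>b\<in>Basis. (frechet_derivative f (at x) v \<bullet> b) * frechet_derivative g (at (f x)) b)"
      by (simp add: linear_sum[OF lin] linear_cmul[OF lin])
    finally show ?thesis .
  qed
  show ?case
  proof (rule Ck_on_SucI[OF assms(1)])
    show "((\<lambda>x. g (f x)) has_derivative
        (\<lambda>v. frechet_derivative g (at (f x)) (frechet_derivative f (at x) v))) (at x)"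
      if "x \<in> S" for x
      using has_derivative_compose[OF Ck_on_SucD[OF f that] Ck_on_SucD[OF g fT[OF that]]] .
    have "Ck_on (enat n) (\<lambda>x. \<Sum>b\<in>Basis. (frechet_derivative f (at x) v \<bullet> b) *
        frechet_derivative g (at (f x)) b) S" for v
    proof (intro Ck_on_sum[OF assms(1)] Ck_on_mult[OF assms(1)])
      fix b :: 'f assume "b \<in> Basis"
      show "Ck_on (enat n) (\<lambda>x. frechet_derivative f (at x) v \<bullet> b) S"
        using f by (intro Ck_on_linear_comp[OF assms(1) bounded_linear_inner_left]) (simp add: Ck_on_Suc)
      show "Ck_on (enat n) (\<lambda>x. frechet_derivative g (at (f x)) b) S"
        using Ck_on_Suc_imp[OF f] g by (intro Suc.IH) (simp_all add: Ck_on_Suc)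
    qed auto
    then show "Ck_on (enat n) (\<lambda>x. frechet_derivative g (at (f x)) (frechet_derivative f (at x) v)) S" for v
      by (rule Ck_on_cong[OF assms(1), rotated]) (simp add: D)
  qed
qed

lemma iter_deriv_cong_open:
  assumes "open S" "x \<in> S" "\<And>y. y \<in> S \<Longrightarrow> f y = g y"
  shows "iter_deriv vs f x = iter_deriv vs g x"
  using assms(2,3)
proof (induction vs arbitrary: f g x)
  case (Cons v vs)
  show ?case unfolding iter_deriv.simps
  proof (rule Cons.IH[OF Cons.prems(1)])
    show "frechet_derivative f (at y) v = frechet_derivative g (at y) v" if "y \<in> S" for y
      by (rule fun_cong[OF frechet_derivative_cong_open[OF assms(1) that]]) (rule Cons.prems(2))
  qed
qed auto

lemma iter_deriv_add_scaled:
  fixes f g :: "'e::euclidean_space \<Rightarrow> real"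
  assumes "open S" "Ck_on (enat (length vs)) f S" "Ck_on (enat (length vs)) g S" "x \<in> S"
  shows "iter_deriv vs (\<lambda>y. f y + t * g y) x = iter_deriv vs f x + t * iter_deriv vs g x"
  using assms(2-4)
proof (induction vs arbitrary: f g x)
  case (Cons v vs)
  have "frechet_derivative (\<lambda>y. f y + t * g y) (at y) v =
      frechet_derivative f (at y) v + t * frechet_derivative g (at y) v" if "y \<in> S" for y
  proof -
    have D: "((\<lambda>y. f y + t * g y) has_derivative
        (\<lambda>v. frechet_derivative f (at y) v + t * frechet_derivative g (at y) v)) (at y)"
      using Cons.prems that by (intro has_derivative_add has_derivative_mult_right) (auto intro: Ck_on_SucD)
    show ?thesis using fun_cong[OF frechet_derivative_at[OF D], of v] by simp
  qed
  note D = this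
  have "iter_deriv (v # vs) (\<lambda>y. f y + t * g y) x =
      iter_deriv vs (\<lambda>y. frechet_derivative f (at y) v + t * frechet_derivative g (at y) v) x"
    unfolding iter_deriv.simps by (rule iter_deriv_cong_open[OF assms(1) Cons.prems(3)]) (rule D)
  also have "\<dots> = iter_deriv (v # vs) f x + t * iter_deriv (v # vs) g x"
    unfolding iter_deriv.simps using Cons.prems by (intro Cons.IH) (simp_all add: Ck_on_Suc)
  finally show ?case .
qed auto

section \<open>Smooth bump functions\<close>

text \<open>
  For \<open>p = 1\<close> this is the classical smooth function \<open>exp (- 1 / t)\<close> that is flat at zero. The
  polynomial factor yields a family closed under differentiation.
\<close>

definition flat :: "real poly \<Rightarrow> real \<Rightarrow> real" where
  "flat p t = (if t > 0 then poly p (1 / t) * exp (- (1 / t)) else 0)"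

lemma poly_times_exp_minus_tendsto_0: "((\<lambda>x. poly q x * exp (- x)) \<longlongrightarrow> (0::real)) at_top"
proof -
  have "((\<lambda>x. \<Sum>i\<le>degree q. coeff q i * (x ^ i / exp x)) \<longlongrightarrow> (\<Sum>i\<le>degree q. coeff q i * 0)) at_top"
    by (intro tendsto_sum tendsto_mult_left tendsto_power_div_exp_0)
  then show ?thesis
    by (simp add: poly_altdef sum_divide_distrib exp_minus divide_inverse sum_distrib_right mult.assoc)
qed

text \<open>
  At zero the difference quotient vanishes in the limit, since \<open>exp (- 1 / t)\<close> decays faster than
  any power of \<open>1 / t\<close> grows.
\<close>

lemma flat_has_derivative:
  "(flat p has_real_derivative flat ((p - pderiv p) * [:0, 0, 1:]) t) (at t)"
proof -
  consider "t < 0" | "t = 0" | "t > 0" by linarith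
  then show ?thesis
  proof cases
    case 1
    have "(flat p has_real_derivative 0) (at t)"
      by (rule has_field_derivative_transform_within_open[OF DERIV_const[of 0], of "{..<0}"])
        (use 1 in \<open>auto simp: flat_def\<close>)
    then show ?thesis using 1 by (simp add: flat_def)
  next
    case 2
    have "((\<lambda>h. poly ([:0, 1:] * p) (inverse h) * exp (- inverse h)) \<longlongrightarrow> 0) (at_right 0)"
      by (rule filterlim_compose[OF poly_times_exp_minus_tendsto_0 filterlim_inverse_at_top_right])
    then have "((\<lambda>h. flat p h / h) \<longlongrightarrow> 0) (at_right 0)"
      by (rule Lim_transform_eventually)
        (auto simp: eventually_at_filter flat_def field_simps)
    moreover have "((\<lambda>h. flat p h / h) \<longlongrightarrow> 0) (at_left 0)"
      by (rule Lim_transform_eventually[OF tendsto_const])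
        (auto simp: eventually_at_filter flat_def)
    ultimately have "((\<lambda>h. flat p h / h) \<longlongrightarrow> 0) (at 0)"
      by (rule filterlim_split_at[rotated])
    then show ?thesis using 2 by (simp add: DERIV_def flat_def)
  next
    case 3
    have "((\<lambda>t. poly p (1 / t) * exp (- (1 / t))) has_real_derivative
        flat ((p - pderiv p) * [:0, 0, 1:]) t) (at t)"
      using 3 by (auto intro!: derivative_eq_intros simp: flat_def field_simps power2_eq_square)
    then show ?thesis
      by (rule has_field_derivative_transform_within_open[of _ _ _ "{0<..}"])
        (use 3 in \<open>auto simp: flat_def\<close>)
  qed
qed

lemma Ck_on_flat: "Ck_on (enat n) (flat p) UNIV"
proof (induction n arbitrary: p)
  case 0
  show ?case using flat_has_derivative[THEN DERIV_isCont]
    by (auto simp: Ck_on_0 continuous_on_eq_continuous_at)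
next
  case (Suc n)
  let ?q = "(p - pderiv p) * [:0, 0, 1:]"
  show ?case
  proof (rule Ck_on_SucI)
    show "(flat p has_derivative (\<lambda>v. flat ?q t * v)) (at t)" for t
      using flat_has_derivative[of p t] by (simp add: has_field_derivative_def)
    show "Ck_on (enat n) (\<lambda>t. flat ?q t * v) UNIV" for v
      by (rule Ck_on_linear_comp[OF _ bounded_linear_mult_left Suc]) simp
  qed simp
qed

lemma flat_1_bounds: "0 \<le> flat 1 t" "flat 1 t \<le> 1"
  by (auto simp: flat_def)

text \<open>
  Scaling the argument by \<open>n\<close> amounts to the \<open>n\<close>-th root of \<open>exp (- 1 / t)\<close>, which remains smooth
  at zero. This is how smooth functions reach the indicator of an open set.
\<close>

lemma flat_1_tendsto: "(\<lambda>n. flat 1 (real n * t)) \<longlonglongrightarrow> (if t > 0 then 1 else 0)"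
proof (cases "t > 0")
  case True
  have "(\<lambda>n. exp (- (1 / real n * (1 / t)))) \<longlonglongrightarrow> exp (- (0 * (1 / t)))"
    by (intro tendsto_intros lim_1_over_n)
  then have "(\<lambda>n. flat 1 (real n * t)) \<longlonglongrightarrow> exp (- (0 * (1 / t)))"
    by (rule Lim_transform_eventually)
      (use True in \<open>auto simp: flat_def intro!: eventually_mono[OF eventually_gt_at_top[of 0]]\<close>)
  then show ?thesis using True by simp
next
  case False
  then have "flat 1 (real n * t) = 0" for n
    by (auto simp: flat_def zero_less_mult_iff)
  then show ?thesis using False by simp
qed

definition ball_bump :: "nat \<Rightarrow> 'e::euclidean_space \<Rightarrow> real \<Rightarrow> 'e \<Rightarrow> real" where
  "ball_bump n c r x = flat 1 (real n * (r\<^sup>2 - (norm (x - c))\<^sup>2))"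

text \<open>
  The squared norm is a polynomial in the coordinates.
\<close>

lemma Ck_on_ball_bump: "Ck_on (enat m) (ball_bump n c r) UNIV"
proof -
  have diff: "Ck_on (enat m) (\<lambda>x. (x - c) \<bullet> b) UNIV" for b
  proof -
    have "Ck_on (enat m) (\<lambda>x. x \<bullet> b + - (c \<bullet> b)) UNIV"
      by (intro Ck_on_add Ck_on_bounded_linear Ck_on_const bounded_linear_inner_left open_UNIV)
    then show ?thesis by (simp add: inner_diff_left)
  qed
  have "Ck_on (enat m) (\<lambda>x. real n * r\<^sup>2 + (\<Sum>b\<in>Basis. - real n * (((x - c) \<bullet> b) * ((x - c) \<bullet> b)))) UNIV"
    by (intro Ck_on_add Ck_on_sum Ck_on_const Ck_on_mult diff open_UNIV finite_Basis)
  moreover have "real n * r\<^sup>2 + (\<Sum>b\<in>Basis. - real n * (((x - c) \<bullet> b) * ((x - c) \<bullet> b))) =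
      real n * (r\<^sup>2 - (norm (x - c))\<^sup>2)" for x
    unfolding power2_norm_eq_inner euclidean_inner[of "x - c" "x - c"]
    by (simp add: sum_distrib_left right_diff_distrib sum_negf)
  ultimately have "Ck_on (enat m) (\<lambda>x. real n * (r\<^sup>2 - (norm (x - c))\<^sup>2)) UNIV" by simp
  from Ck_on_compose[OF _ _ _ this Ck_on_flat] show ?thesis
    unfolding ball_bump_def by simp
qed

lemma ball_bump_bounds: "0 \<le> ball_bump n c r x" "ball_bump n c r x \<le> 1"
  by (simp_all add: ball_bump_def flat_1_bounds)

lemma sq_diff_pos_iff: "r > 0 \<Longrightarrow> 0 < r\<^sup>2 - (norm (x - c))\<^sup>2 \<longleftrightarrow> x \<in> ball c r"
  using abs_le_square_iff[of r "norm (x - c)"]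
  by (simp add: dist_norm norm_minus_commute[of c] linorder_not_le[symmetric])

lemma ball_bump_tendsto:
  assumes "r > 0" shows "(\<lambda>n. ball_bump n c r x) \<longlonglongrightarrow> indicator (ball c r) x"
  using flat_1_tendsto[of "r\<^sup>2 - (norm (x - c))\<^sup>2"] assms
  unfolding ball_bump_def sq_diff_pos_iff[OF assms] indicator_def of_bool_def by simp

lemma ball_bump_eq_0:
  assumes "r > 0" "x \<notin> ball c r" shows "ball_bump n c r x = 0"
  using assms sq_diff_pos_iff[OF assms(1), of x c]
  by (auto simp: ball_bump_def flat_def zero_less_mult_iff)

section \<open>Smooth functions on manifolds and their products\<close>

lemma is_chartD:
  assumes "is_chart (U, \<phi>)"
  shows "open U" "open (\<phi> ` U)" "continuous_on U \<phi>" "continuous_on (\<phi> ` U) (inv_into U \<phi>)" "inj_on \<phi> U"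
  using assms unfolding is_chart_def homeomorphism_def by (auto intro: inj_on_inverseI)

lemma chart_image_open:
  assumes "is_chart (U, \<phi>)" "open G" "G \<subseteq> U"
  shows "open (\<phi> ` G)"
proof -
  note U = is_chartD[OF assms(1)]
  have "\<phi> ` G = \<phi> ` U \<inter> inv_into U \<phi> -` G"
    using assms(3) U(5) by (auto simp: inv_into_f_f image_iff subset_iff)
  then show ?thesis
    using continuous_open_preimage[OF U(4,2) assms(2)] by simp
qed

lemma chart_ball_exists:
  assumes "is_chart (U, \<phi>)" "open G" "x \<in> G" "x \<in> U"
  obtains r where "r > 0" "cball (\<phi> x) r \<subseteq> \<phi> ` (U \<inter> G)"
proof -
  have "open (\<phi> ` (U \<inter> G))"
    using assms is_chartD[OF assms(1)] by (intro chart_image_open[OF assms(1)]) auto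
  then show ?thesis using that assms by (auto simp: open_contains_cball)
qed

lemma chart_ball_open:
  assumes "is_chart (U, \<phi>)"
  shows "open {y \<in> U. \<phi> y \<in> ball c r}"
proof -
  note U = is_chartD[OF assms(1)]
  have "{y \<in> U. \<phi> y \<in> ball c r} = U \<inter> \<phi> -` ball c r" by auto
  then show ?thesis using continuous_open_preimage[OF U(3,1) open_ball] by simp
qed

text \<open>
  The Hausdorff property enters here: it keeps the support of a bump function away from the points
  outside of the chart, so that extension by zero is smooth.
\<close>

lemma chart_cball_closed:
  fixes U :: "'a::t2_space set"
  assumes "is_chart (U, \<phi>)" "cball c r \<subseteq> \<phi> ` U"
  shows "closed {y \<in> U. \<phi> y \<in> cball c r}"
proof -
  note U = is_chartD[OF assms(1)]
  have "compact (inv_into U \<phi> ` cball c r)"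
    by (rule compact_continuous_image[OF continuous_on_subset[OF U(4) assms(2)] compact_cball])
  moreover have "inv_into U \<phi> ` cball c r = {y \<in> U. \<phi> y \<in> cball c r}"
  proof (intro equalityI subsetI)
    fix y assume "y \<in> inv_into U \<phi> ` cball c r"
    then obtain z where "z \<in> cball c r" "y = inv_into U \<phi> z" by auto
    with assms(2) show "y \<in> {y \<in> U. \<phi> y \<in> cball c r}"
      by (auto simp: f_inv_into_f inv_into_into subset_iff)
  next
    fix y assume "y \<in> {y \<in> U. \<phi> y \<in> cball c r}"
    then show "y \<in> inv_into U \<phi> ` cball c r"
      using U(5) by (intro image_eqI[of _ _ "\<phi> y"]) (auto simp: inv_into_f_f)
  qed
  ultimately show ?thesis using compact_imp_closed by auto
qed

lemma Ck_functions_iff: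
  "f \<in> Ck_functions A k \<longleftrightarrow> (\<forall>U \<phi>. (U, \<phi>) \<in> A \<longrightarrow> Ck_on k (\<lambda>x. f (inv_into U \<phi> x)) (\<phi> ` U))"
  by (auto simp: Ck_functions_def)

text \<open>
  Seen in another chart, the function is a smooth function of a transition map near the points of
  \<open>U\<close>, and it vanishes on the complement of a closed subset of \<open>U\<close>. These two open sets cover the
  chart.
\<close>

lemma chart_bump_smooth:
  fixes A :: "('a::t2_space, 'e::euclidean_space) chart set"
  assumes "smooth_atlas A" "(U, \<phi>) \<in> A" "r > 0" "cball c r \<subseteq> \<phi> ` U"
  shows "(\<lambda>x. if x \<in> U then ball_bump n c r (\<phi> x) else 0) \<in> Ck_functions A \<infinity>"
  unfolding Ck_functions_iff Ck_on_infty_iff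
proof (intro allI impI)
  fix V \<psi> m assume V: "(V, \<psi>) \<in> A"
  let ?h = "\<lambda>x. if x \<in> U then ball_bump n c r (\<phi> x) else 0"
  let ?K = "{y \<in> U. \<phi> y \<in> cball c r}"
  have chU: "is_chart (U, \<phi>)" and chV: "is_chart (V, \<psi>)"
    and trans: "Ck_on (enat m) (\<lambda>x. \<phi> (inv_into V \<psi> x)) (\<psi> ` (V \<inter> U))"
    using assms(1,2) V unfolding smooth_atlas_def smooth_transition_def Ck_on_infty_iff by fastforce+
  note U = is_chartD[OF chU] and VV = is_chartD[OF chV]
  have o1: "open (\<psi> ` (V \<inter> U))"
    using U VV by (intro chart_image_open[OF chV]) auto
  have o2: "open (\<psi> ` (V - ?K))"
    using VV(1) chart_cball_closed[OF chU assms(4)] by (intro chart_image_open[OF chV]) auto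
  have "Ck_on (enat m) (\<lambda>y. ball_bump n c r (\<phi> (inv_into V \<psi> y))) (\<psi> ` (V \<inter> U))"
    by (rule Ck_on_compose[OF o1 open_UNIV _ trans Ck_on_ball_bump]) simp
  then have "Ck_on (enat m) (\<lambda>y. ?h (inv_into V \<psi> y)) (\<psi> ` (V \<inter> U))"
    by (rule Ck_on_cong[OF o1, rotated]) (use VV(5) in \<open>auto simp: inv_into_f_f\<close>)
  moreover have "Ck_on (enat m) (\<lambda>y. ?h (inv_into V \<psi> y)) (\<psi> ` (V - ?K))"
    by (rule Ck_on_cong[OF o2 _ Ck_on_const[OF o2, of _ 0]])
      (use VV(5) assms(3) in \<open>auto simp: inv_into_f_f intro!: ball_bump_eq_0\<close>)
  moreover have "\<psi> ` (V \<inter> U) \<union> \<psi> ` (V - ?K) = \<psi> ` V" by auto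
  ultimately show "Ck_on (enat m) (\<lambda>y. ?h (inv_into V \<psi> y)) (\<psi> ` V)"
    using Ck_on_Un[OF o1 o2, of "enat m" "\<lambda>y. ?h (inv_into V \<psi> y)"] by simp
qed

definition exhausts :: "(nat \<Rightarrow> 'a \<Rightarrow> real) \<Rightarrow> 'a set \<Rightarrow> bool" where
  "exhausts g W \<longleftrightarrow> (\<forall>n x. 0 \<le> g n x \<and> g n x \<le> 1) \<and> (\<forall>x. (\<lambda>n. g n x) \<longlonglongrightarrow> indicator W x)"

lemma exhausts_Int:
  assumes "exhausts g W" "exhausts h V"
  shows "exhausts (\<lambda>n x. g n x * h n x) (W \<inter> V)"
  using assms unfolding exhausts_def
  by (simp add: indicator_inter_arith mult_le_one tendsto_mult)

lemma exhausts_Times: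
  assumes "exhausts g W" "exhausts h V"
  shows "exhausts (\<lambda>n (x, y). g n x * h n y) (W \<times> V)"
  using assms unfolding exhausts_def
  by (simp add: split_beta' indicator_times mult_le_one tendsto_mult)

lemma smooth_exhaustible_base:
  fixes A :: "('a::t2_space, 'e::euclidean_space) chart set"
  assumes "smooth_atlas A" "open G" "x \<in> G"
  obtains W g where "open W" "x \<in> W" "W \<subseteq> G" "exhausts g W" "\<And>n. g n \<in> Ck_functions A \<infinity>"
proof -
  obtain U \<phi> where U: "(U, \<phi>) \<in> A" "x \<in> U"
    using assms(1) unfolding smooth_atlas_def by fastforce
  have ch: "is_chart (U, \<phi>)" using assms(1) U unfolding smooth_atlas_def by auto
  obtain r where r: "r > 0" "cball (\<phi> x) r \<subseteq> \<phi> ` (U \<inter> G)"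
    using chart_ball_exists[OF ch assms(2,3) U(2)] .
  let ?W = "{y \<in> U. \<phi> y \<in> ball (\<phi> x) r}"
  let ?g = "\<lambda>n y. if y \<in> U then ball_bump n (\<phi> x) r (\<phi> y) else 0"
  show ?thesis
  proof (rule that)
    show "open ?W" by (rule chart_ball_open[OF ch])
    show "x \<in> ?W" using U r by simp
    show "?W \<subseteq> G"
    proof
      fix y assume y: "y \<in> ?W"
      then have "\<phi> y \<in> cball (\<phi> x) r" by auto
      then obtain z where "z \<in> U \<inter> G" "\<phi> y = \<phi> z" using r(2) by blast
      then show "y \<in> G" using y is_chartD(5)[OF ch] by (auto dest: inj_onD)
    qed
    show "exhausts ?g ?W"
      unfolding exhausts_def
    proof (intro conjI allI)
      show "(\<lambda>n. ?g n y) \<longlonglongrightarrow> indicator ?W y" for y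
        using ball_bump_tendsto[OF r(1), of "\<phi> x" "\<phi> y"] by (cases "y \<in> U") (simp_all add: indicator_def)
    qed (auto simp: ball_bump_bounds)
    show "?g n \<in> Ck_functions A \<infinity>" for n
      using r(2) by (intro chart_bump_smooth[OF assms(1) U(1) r(1)]) auto
  qed
qed

lemma inv_into_map_prod:
  assumes "inj_on \<phi> U" "inj_on \<psi> V" "x \<in> \<phi> ` U" "y \<in> \<psi> ` V"
  shows "inv_into (U \<times> V) (map_prod \<phi> \<psi>) (x, y) = (inv_into U \<phi> x, inv_into V \<psi> y)"
  using assms by (intro inv_into_f_eq map_prod_inj_on) (auto simp: inv_into_into f_inv_into_f)

lemma map_prod_image: "map_prod \<phi> \<psi> ` (U \<times> V) = \<phi> ` U \<times> \<psi> ` V"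
  by (rule map_prod_surj_on[OF refl refl])

lemma is_chart_prod:
  assumes "is_chart (U, \<phi>)" "is_chart (V, \<psi>)"
  shows "is_chart (U \<times> V, map_prod \<phi> \<psi>)"
proof -
  note U = is_chartD[OF assms(1)] and V = is_chartD[OF assms(2)]
  have inv: "inv_into (U \<times> V) (map_prod \<phi> \<psi>) z = (inv_into U \<phi> (fst z), inv_into V \<psi> (snd z))"
    if "z \<in> \<phi> ` U \<times> \<psi> ` V" for z
    using inv_into_map_prod[OF U(5) V(5), of "fst z" "snd z"] that by auto
  have "continuous_on (U \<times> V) (\<lambda>z. (\<phi> (fst z), \<psi> (snd z)))"
    by (intro continuous_on_Pair continuous_on_compose2[OF U(3)] continuous_on_compose2[OF V(3)]
        continuous_on_fst continuous_on_snd continuous_on_id) auto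
  then have "continuous_on (U \<times> V) (map_prod \<phi> \<psi>)"
    by (simp add: map_prod_def split_beta')
  moreover have "continuous_on (\<phi> ` U \<times> \<psi> ` V) (\<lambda>z. (inv_into U \<phi> (fst z), inv_into V \<psi> (snd z)))"
    by (intro continuous_on_Pair continuous_on_compose2[OF U(4)] continuous_on_compose2[OF V(4)]
        continuous_on_fst continuous_on_snd continuous_on_id) auto
  then have "continuous_on (\<phi> ` U \<times> \<psi> ` V) (inv_into (U \<times> V) (map_prod \<phi> \<psi>))"
    using inv by (simp cong: continuous_on_cong)
  moreover have inj: "inj_on (map_prod \<phi> \<psi>) (U \<times> V)" using U(5) V(5) by (rule map_prod_inj_on)
  have "inv_into (U \<times> V) (map_prod \<phi> \<psi>) ` (\<phi> ` U \<times> \<psi> ` V) = U \<times> V"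
    unfolding map_prod_image[symmetric] using inv_into_image_cancel[OF inj order_refl] .
  ultimately show ?thesis
    using U(1,2,5) V(1,2,5) inj unfolding is_chart_def homeomorphism_def case_prod_conv map_prod_image
    by (auto simp: open_Times inv_into_f_f map_prod_image inv)
qed

lemma prod_atlas_charts:
  assumes "smooth_atlas A" "smooth_atlas B"
  shows "\<And>C. C \<in> prod_atlas A B \<Longrightarrow> is_chart C" "(\<Union>C\<in>prod_atlas A B. fst C) = UNIV"
proof -
  show "is_chart C" if "C \<in> prod_atlas A B" for C
    using that assms is_chart_prod unfolding prod_atlas_def smooth_atlas_def by blast
  have "\<exists>C\<in>prod_atlas A B. (x, y) \<in> fst C" for x y
  proof -
    obtain U \<phi> V \<psi> where "(U, \<phi>) \<in> A" "x \<in> U" "(V, \<psi>) \<in> B" "y \<in> V"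
      using assms unfolding smooth_atlas_def by (metis UNIV_I UN_iff prod.collapse)
    then show ?thesis
      by (intro bexI[of _ "(U \<times> V, map_prod \<phi> \<psi>)"]) (auto simp: prod_atlas_def)
  qed
  then show "(\<Union>C\<in>prod_atlas A B. fst C) = UNIV" by auto
qed

lemma Ck_functions_mult:
  assumes "\<And>C. C \<in> A \<Longrightarrow> is_chart C" "f \<in> Ck_functions A \<infinity>" "g \<in> Ck_functions A \<infinity>"
  shows "(\<lambda>x. f x * g x) \<in> Ck_functions A \<infinity>"
  using assms unfolding Ck_functions_iff Ck_on_infty_iff
  by (auto intro!: Ck_on_mult is_chartD(2))

lemma Ck_functions_const:
  assumes "\<And>C. C \<in> A \<Longrightarrow> is_chart C"
  shows "(\<lambda>x. c) \<in> Ck_functions A \<infinity>"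
  using assms unfolding Ck_functions_iff Ck_on_infty_iff
  by (auto intro!: Ck_on_const is_chartD(2))

text \<open>
  In product charts both factors are compositions with the linear projections.
\<close>

lemma Ck_functions_times:
  assumes "smooth_atlas A" "smooth_atlas B" "f \<in> Ck_functions A \<infinity>" "g \<in> Ck_functions B \<infinity>"
  shows "(\<lambda>(x, y). f x * g y) \<in> Ck_functions (prod_atlas A B) \<infinity>"
  unfolding Ck_functions_iff Ck_on_infty_iff
proof (intro allI impI)
  fix W w m assume "(W, w) \<in> prod_atlas A B"
  then obtain U \<phi> V \<psi> where UV: "(U, \<phi>) \<in> A" "(V, \<psi>) \<in> B" and W: "W = U \<times> V" "w = map_prod \<phi> \<psi>"
    by (auto simp: prod_atlas_def)
  have "is_chart (U, \<phi>)" "is_chart (V, \<psi>)" using assms(1,2) UV unfolding smooth_atlas_def by auto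
  note U = is_chartD[OF this(1)] and V = is_chartD[OF this(2)]
  have oS: "open (\<phi> ` U \<times> \<psi> ` V)" using U V by (intro open_Times)
  have "Ck_on (enat m) (\<lambda>z. f (inv_into U \<phi> (fst z))) (\<phi> ` U \<times> \<psi> ` V)"
    by (rule Ck_on_compose[OF oS U(2) _ Ck_on_bounded_linear[OF oS bounded_linear_fst]])
      (use assms(3) UV in \<open>auto simp: Ck_functions_iff Ck_on_infty_iff\<close>)
  moreover have "Ck_on (enat m) (\<lambda>z. g (inv_into V \<psi> (snd z))) (\<phi> ` U \<times> \<psi> ` V)"
    by (rule Ck_on_compose[OF oS V(2) _ Ck_on_bounded_linear[OF oS bounded_linear_snd]])
      (use assms(4) UV in \<open>auto simp: Ck_functions_iff Ck_on_infty_iff\<close>)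
  ultimately have "Ck_on (enat m) (\<lambda>z. f (inv_into U \<phi> (fst z)) * g (inv_into V \<psi> (snd z))) (\<phi> ` U \<times> \<psi> ` V)"
    by (rule Ck_on_mult[OF oS])
  then show "Ck_on (enat m) (\<lambda>z. (case inv_into W w z of (x, y) \<Rightarrow> f x * g y)) (w ` W)"
    unfolding W map_prod_image
    by (rule Ck_on_cong[OF oS, rotated]) (use U(5) V(5) in \<open>auto simp: inv_into_map_prod\<close>)
qed

lemma Ck_functions_mono: "f \<in> Ck_functions A k \<Longrightarrow> j \<le> k \<Longrightarrow> f \<in> Ck_functions A j"
  unfolding Ck_functions_iff by (auto intro: Ck_on_mono)

section \<open>Regularity of Borel measures on compact spaces\<close>

lemma compact_t2_regular:
  fixes A :: "'a::t2_space set"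
  assumes "compact (UNIV :: 'a set)" "open A" "x \<in> A"
  obtains W where "open W" "x \<in> W" "closure W \<subseteq> A"
proof -
  have "compact (- A)"
    using compact_Int_closed[OF assms(1), of "- A"] assms(2) by (simp add: closed_def)
  moreover have "disjnt {x} (- A)" using assms(3) by (simp add: disjnt_def)
  moreover have "Hausdorff_space (euclidean :: 'a topology)" by (simp add: Hausdorff_space_def disjnt_def) (metis hausdorff)
  ultimately obtain U V where UV: "open U" "open V" "{x} \<subseteq> U" "- A \<subseteq> V" "disjnt U V"
    unfolding Hausdorff_space_compact_sets by (metis compact_sing compactin_euclidean_iff open_openin)
  have "U \<subseteq> - V" using UV(5) by (auto simp: disjnt_def)
  then have "closure U \<subseteq> - V" using UV(2) by (intro closure_minimal) auto
  then show ?thesis using UV by (intro that[of U]) auto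
qed

text \<open>
  By regularity an open set is covered by open sets whose closures it contains, and by
  Lindelof's theorem countably many of them are enough.
\<close>

lemma open_eq_countable_Union_closed:
  fixes A :: "'a::{t2_space, second_countable_topology} set"
  assumes "compact (UNIV :: 'a set)" "open A"
  obtains D :: "nat \<Rightarrow> 'a set" where "\<And>n. closed (D n)" "A = (\<Union>n. D n)"
proof -
  let ?F = "{W. open W \<and> closure W \<subseteq> A}"
  obtain F where F: "F \<subseteq> ?F" "countable F" "\<Union>F = \<Union>?F"
    by (rule Lindelof[of ?F]) auto
  have "A \<subseteq> \<Union>?F" by (auto elim: compact_t2_regular[OF assms])
  then have "A \<subseteq> \<Union>F" using F(3) by simp
  also have "\<dots> \<subseteq> \<Union>(closure ` F)" using closure_subset by blast
  finally have "A \<subseteq> \<Union>(closure ` F)" .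
  moreover have "\<Union>(closure ` F) \<subseteq> A" using F(1) by auto
  ultimately have A: "A = \<Union>(closure ` F)" by (rule equalityI)
  show ?thesis
  proof (cases "F = {}")
    case True
    then show ?thesis using A by (intro that[of "\<lambda>_. {}"]) auto
  next
    case False
    show ?thesis
    proof (rule that[of "\<lambda>n. closure (from_nat_into F n)"])
      show "A = (\<Union>n. closure (from_nat_into F n))"
        using A range_from_nat_into[OF False F(2)] by (metis image_image)
    qed simp
  qed
qed

text \<open>
  The sets that can be approximated in measure by closed sets from inside and by open sets from
  outside form a sigma-algebra; for a countable union, finitely many of the inner closed sets
  suffice up to an arbitrarily small error. Open sets belong to it because they are countable
  unions of closed sets.
\<close>

lemma regular_Borel_measure:
  fixes M :: "'a::{t2_space, second_countable_topology} measure"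
  assumes "compact (UNIV :: 'a set)" "finite_measure M" and [measurable_cong]: "sets M = sets borel"
    and "A \<in> sets borel" "e > 0"
  obtains K U where "closed K" "open U" "K \<subseteq> A" "A \<subseteq> U" "measure M (U - K) < e"
proof -
  interpret finite_measure M by fact
  have clo: "K \<in> sets M" if "closed K" for K using that assms(3) by simp
  have opn: "U \<in> sets M" if "open U" for U using that assms(3) by simp
  have "A \<in> sigma_sets UNIV {S. open S}"
    using assms(4) by (simp add: borel_def)
  then have "\<forall>e>0. \<exists>K U. closed K \<and> open U \<and> K \<subseteq> A \<and> A \<subseteq> U \<and> measure M (U - K) < e"
  proof (induction A)
    case (Basic A)
    then have "open A" by simp
    then obtain D :: "nat \<Rightarrow> 'a set" where D: "\<And>n. closed (D n)" "A = (\<Union>n. D n)"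
      using open_eq_countable_Union_closed[OF assms(1)] by metis
    show ?case
    proof (intro allI impI)
      fix e :: real assume "e > 0"
      have "(\<lambda>n. measure M (A - (\<Union>i\<le>n. D i))) \<longlonglongrightarrow> measure M (\<Inter>n. A - (\<Union>i\<le>n. D i))"
        using D(1) \<open>open A\<close>
        by (intro finite_Lim_measure_decseq) (auto simp: decseq_def intro!: sets.Diff sets.finite_UN clo opn)
      moreover have "(\<Inter>n. A - (\<Union>i\<le>n. D i)) = {}" using D(2) by auto
      ultimately have "(\<lambda>n. measure M (A - (\<Union>i\<le>n. D i))) \<longlonglongrightarrow> 0"
        by (simp only: measure_empty)
      then have "\<forall>\<^sub>F n in sequentially. measure M (A - (\<Union>i\<le>n. D i)) < e"
        using \<open>e > 0\<close> by (rule order_tendstoD(2))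
      then obtain n where "measure M (A - (\<Union>i\<le>n. D i)) < e"
        using eventually_happens by fastforce
      then show "\<exists>K U. closed K \<and> open U \<and> K \<subseteq> A \<and> A \<subseteq> U \<and> measure M (U - K) < e"
        using D \<open>open A\<close> by (intro exI[of _ "\<Union>i\<le>n. D i"] exI[of _ A]) auto
    qed
  next
    case Empty
    then show ?case by (intro allI impI exI[of _ "{}"]) auto
  next
    case (Compl A)
    show ?case
    proof (intro allI impI)
      fix e :: real assume "e > 0"
      then obtain K U where "closed K" "open U" "K \<subseteq> A" "A \<subseteq> U" "measure M (U - K) < e"
        using Compl.IH by meson
      moreover have "- K - - U = U - K" by auto
      ultimately show "\<exists>K U. closed K \<and> open U \<and> K \<subseteq> UNIV - A \<and> UNIV - A \<subseteq> U \<and> measure M (U - K) < e"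
        by (intro exI[of _ "- U"] exI[of _ "- K"]) auto
    qed
  next
    case (Union A)
    show ?case
    proof (intro allI impI)
      fix e :: real assume e: "e > 0"
      have "\<exists>K U. closed K \<and> open U \<and> K \<subseteq> A i \<and> A i \<subseteq> U \<and> measure M (U - K) < e / 2 * (1 / 2) ^ Suc i" for i
        by (rule Union.IH[of i, rule_format]) (use e in simp)
      then obtain K U where KU: "\<And>i. closed (K i)" "\<And>i. open (U i)" "\<And>i. K i \<subseteq> A i" "\<And>i. A i \<subseteq> U i"
        "\<And>i. measure M (U i - K i) < e / 2 * (1 / 2) ^ Suc i" by metis
      \<comment> \<open>The total error is at most \<open>e / 2\<close>, which leaves room for a strict inequality and for the
        truncation of the union of the \<open>K i\<close>.\<close>
      have s: "(\<lambda>i. e / 2 * (1 / 2) ^ Suc i) sums (e / 2)"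
        using sums_mult[OF power_half_series, of "e / 2"] by simp
      have summ: "summable (\<lambda>i. measure M (U i - K i))"
        by (rule summable_comparison_test'[OF sums_summable[OF s], of 0])
          (simp only: real_norm_def abs_of_nonneg[OF measure_nonneg] less_imp_le[OF KU(5)])
      have "measure M (\<Union>i. U i - K i) \<le> (\<Sum>i. measure M (U i - K i))"
        using KU(1,2) by (intro finite_measure_subadditive_countably summ) (auto intro!: sets.Diff clo opn)
      also have "\<dots> \<le> e / 2"
        using suminf_le[OF less_imp_le[OF KU(5)] summ sums_summable[OF s]] sums_unique[OF s] by simp
      also have "\<dots> < e" using e by simp
      finally have lt: "measure M (\<Union>i. U i - K i) < e" .
      have "measure M ((\<Union>i. U i) - (\<Union>i. K i)) \<le> measure M (\<Union>i. U i - K i)"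
        using KU(1,2) by (intro finite_measure_mono) (auto intro!: sets.countable_UN clo opn)
      also note lt
      finally have "measure M ((\<Union>i. U i) - (\<Union>i. K i)) < e" .
      moreover have "(\<lambda>n. measure M ((\<Union>i. U i) - (\<Union>i\<le>n. K i))) \<longlonglongrightarrow>
          measure M (\<Inter>n. (\<Union>i. U i) - (\<Union>i\<le>n. K i))"
        using KU(1,2) by (intro finite_Lim_measure_decseq)
          (auto simp: decseq_def intro!: sets.Diff sets.finite_UN clo opn)
      moreover have "(\<Inter>n. (\<Union>i. U i) - (\<Union>i\<le>n. K i)) = (\<Union>i. U i) - (\<Union>i. K i)" by auto
      ultimately have "\<forall>\<^sub>F n in sequentially. measure M ((\<Union>i. U i) - (\<Union>i\<le>n. K i)) < e"
        using order_tendstoD(2) by (simp only:)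
      then obtain n where "measure M ((\<Union>i. U i) - (\<Union>i\<le>n. K i)) < e"
        using eventually_happens by fastforce
      then show "\<exists>K U. closed K \<and> open U \<and> K \<subseteq> (\<Union>i. A i) \<and> (\<Union>i. A i) \<subseteq> U \<and> measure M (U - K) < e"
        using KU(1-4) by (intro exI[of _ "\<Union>i\<le>n. K i"] exI[of _ "\<Union>i. U i"]) (auto; blast)
    qed
  qed
  then show ?thesis using assms(5) that by blast
qed

section \<open>Existence of optimal plans\<close>

text \<open>
  Tychonoff's theorem for the cube \<open>[0, 1]\<close> to the power of the index type. The index type may be
  uncountable, so the limit is taken along a filter instead of a subsequence.
\<close>

lemma bounded_functions_cluster_point:
  fixes f :: "nat \<Rightarrow> 'i \<Rightarrow> real"
  assumes "\<And>n i. f n i \<in> {0..1}"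
  obtains F L where "F \<noteq> bot" "F \<le> sequentially" "\<And>i. ((\<lambda>n. f n i) \<longlongrightarrow> L i) F"
proof -
  let ?C = "PiE UNIV (\<lambda>_::'i. {0..1::real})"
  have "compactin (product_topology (\<lambda>_. euclidean) UNIV) ?C"
    unfolding compactin_PiE by simp
  then have "compact ?C" by (simp add: euclidean_product_topology)
  moreover have "filtermap f sequentially \<noteq> bot" by (simp add: filtermap_bot_iff)
  moreover have "eventually (\<lambda>x. x \<in> ?C) (filtermap f sequentially)"
    using assms by (simp add: eventually_filtermap PiE_UNIV_domain)
  ultimately obtain L where L: "inf (nhds L) (filtermap f sequentially) \<noteq> bot"
    unfolding compact_filter by blast
  \<comment> \<open>The coarsest filter below \<^term>\<open>sequentially\<close> along which \<open>f\<close> converges to \<open>L\<close>; being proper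
    means precisely that \<open>L\<close> is a cluster point.\<close>
  define F where "F = inf sequentially (filtercomap f (nhds L))"
  show ?thesis
  proof (rule that)
    show "F \<noteq> bot"
    proof
      assume "F = bot"
      then have "eventually (\<lambda>_. False) F" by simp
      then obtain Q R where QR: "eventually Q sequentially" "eventually R (filtercomap f (nhds L))"
        "\<And>n. \<not> (Q n \<and> R n)" unfolding F_def eventually_inf by blast
      then obtain P where P: "eventually P (nhds L)" "\<And>n. P (f n) \<Longrightarrow> R n"
        unfolding eventually_filtercomap by blast
      have "eventually (\<lambda>y. \<not> P y) (filtermap f sequentially)"
        unfolding eventually_filtermap using QR(1) by (rule eventually_mono) (use QR(3) P(2) in blast)
      then have "eventually (\<lambda>_. False) (inf (nhds L) (filtermap f sequentially))"
        unfolding eventually_inf using P(1) by blast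
      then show False using L by (simp add: eventually_False)
    qed
    show "F \<le> sequentially" by (simp add: F_def)
    have "filterlim f (nhds L) F"
      unfolding F_def by (rule filterlim_mono[OF filterlim_filtercomap order_refl]) simp
    then show "((\<lambda>n. f n i) \<longlongrightarrow> L i) F" for i
      using continuous_on_tendsto_compose[OF continuous_on_product_coordinates[of i], of f L F] by simp
  qed
qed

locale compact_marginals =
  fixes \<mu> :: "'a::{t2_space, second_countable_topology} measure"
    and \<nu> :: "'b::{t2_space, second_countable_topology} measure"
  assumes compact_a: "compact (UNIV :: 'a set)" and compact_b: "compact (UNIV :: 'b set)"
    and prob_\<mu>: "prob_space \<mu>" and sets_\<mu>: "sets \<mu> = sets borel"
    and prob_\<nu>: "prob_space \<nu>" and sets_\<nu>: "sets \<nu> = sets borel"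
begin

lemma compact_prod: "compact (UNIV :: ('a \<times> 'b) set)"
  using compact_Times[OF compact_a compact_b] by (simp add: UNIV_Times_UNIV)

lemma continuous_bounded:
  fixes c :: "'a \<times> 'b \<Rightarrow> real"
  assumes "continuous_on UNIV c"
  obtains C where "C > 0" "\<And>z. \<bar>c z\<bar> \<le> C"
proof -
  have "bounded (range c)"
    using compact_continuous_image[OF assms compact_prod] by (rule compact_imp_bounded)
  then show ?thesis using that unfolding bounded_pos by auto
qed

lemma plan_sets: "\<gamma> \<in> transport_plans \<mu> \<nu> \<Longrightarrow> sets \<gamma> = sets borel"
  by (simp add: transport_plans_def)

lemma plan_space: "\<gamma> \<in> transport_plans \<mu> \<nu> \<Longrightarrow> space \<gamma> = UNIV"
  using sets_eq_imp_space_eq[OF plan_sets] by simp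

lemma plan_measurable_fst: "\<gamma> \<in> transport_plans \<mu> \<nu> \<Longrightarrow> fst \<in> measurable \<gamma> borel"
  using measurable_cong_sets[OF plan_sets refl, of \<gamma> "borel :: 'a measure"]
  by (simp add: borel_measurable_continuous_onI continuous_on_fst)

lemma plan_measurable_snd: "\<gamma> \<in> transport_plans \<mu> \<nu> \<Longrightarrow> snd \<in> measurable \<gamma> borel"
  using measurable_cong_sets[OF plan_sets refl, of \<gamma> "borel :: 'b measure"]
  by (simp add: borel_measurable_continuous_onI continuous_on_snd)

lemma plan_prob_space: "\<gamma> \<in> transport_plans \<mu> \<nu> \<Longrightarrow> prob_space \<gamma>"
  using prob_\<mu> prob_space_distrD[OF plan_measurable_fst] by (auto simp: transport_plans_def)

lemma plan_marginal_fst: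
  assumes "\<gamma> \<in> transport_plans \<mu> \<nu>" "A \<in> sets borel"
  shows "measure \<gamma> (A \<times> UNIV) = measure \<mu> A"
proof -
  have "measure \<mu> A = measure (distr \<gamma> borel fst) A" using assms by (simp add: transport_plans_def)
  also have "\<dots> = measure \<gamma> (fst -` A \<inter> space \<gamma>)"
    by (rule measure_distr[OF plan_measurable_fst[OF assms(1)] assms(2)])
  also have "fst -` A \<inter> space \<gamma> = A \<times> UNIV" using plan_space[OF assms(1)] by auto
  finally show ?thesis by simp
qed

lemma plan_marginal_snd:
  assumes "\<gamma> \<in> transport_plans \<mu> \<nu>" "B \<in> sets borel"
  shows "measure \<gamma> (UNIV \<times> B) = measure \<nu> B"
proof -
  have "measure \<nu> B = measure (distr \<gamma> borel snd) B" using assms by (simp add: transport_plans_def)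
  also have "\<dots> = measure \<gamma> (snd -` B \<inter> space \<gamma>)"
    by (rule measure_distr[OF plan_measurable_snd[OF assms(1)] assms(2)])
  also have "snd -` B \<inter> space \<gamma> = UNIV \<times> B" using plan_space[OF assms(1)] by auto
  finally show ?thesis by simp
qed

lemma plan_integrable:
  fixes g :: "'a \<times> 'b \<Rightarrow> real"
  assumes "\<gamma> \<in> transport_plans \<mu> \<nu>" "g \<in> borel_measurable borel" "\<And>z. \<bar>g z\<bar> \<le> C"
  shows "integrable \<gamma> g"
proof -
  interpret prob_space \<gamma> by (rule plan_prob_space[OF assms(1)])
  show ?thesis
    using assms(3) by (intro integrable_const_bound[of _ C])
      (auto simp: assms(2) measurable_cong_sets[OF plan_sets[OF assms(1)] refl])
qed

lemma plan_integrable_continuous: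
  fixes c :: "'a \<times> 'b \<Rightarrow> real"
  assumes "\<gamma> \<in> transport_plans \<mu> \<nu>" "continuous_on UNIV c"
  shows "integrable \<gamma> c"
proof -
  obtain C where "\<And>z. \<bar>c z\<bar> \<le> C" using continuous_bounded[OF assms(2)] by blast
  then show ?thesis
    by (rule plan_integrable[OF assms(1) borel_measurable_continuous_onI[OF assms(2)]])
qed

lemma rect_borel: "A \<in> sets borel \<Longrightarrow> B \<in> sets borel \<Longrightarrow> A \<times> B \<in> sets (borel :: ('a \<times> 'b) measure)"
  unfolding borel_prod[symmetric] by simp

lemma transport_plansI:
  fixes \<gamma> :: "('a \<times> 'b) measure"
  assumes "sets \<gamma> = sets borel"
    and "\<And>A. A \<in> sets borel \<Longrightarrow> emeasure \<gamma> (A \<times> UNIV) = emeasure \<mu> A"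
    and "\<And>B. B \<in> sets borel \<Longrightarrow> emeasure \<gamma> (UNIV \<times> B) = emeasure \<nu> B"
  shows "\<gamma> \<in> transport_plans \<mu> \<nu>"
proof -
  have sp: "space \<gamma> = UNIV" using sets_eq_imp_space_eq[OF assms(1)] by simp
  have "fst \<in> measurable \<gamma> (borel :: 'a measure)" "snd \<in> measurable \<gamma> (borel :: 'b measure)"
    unfolding measurable_cong_sets[OF assms(1) refl]
    by (simp_all add: borel_measurable_continuous_onI continuous_on_fst continuous_on_snd)
  then have "distr \<gamma> borel fst = \<mu>" "distr \<gamma> borel snd = \<nu>"
    using assms(2,3) sp
    by (auto intro!: measure_eqI simp: sets_\<mu> sets_\<nu> emeasure_distr vimage_fst vimage_snd)
  then show ?thesis using assms(1) by (simp add: transport_plans_def)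
qed

lemma transport_plans_nonempty: "transport_plans \<mu> \<nu> \<noteq> {}"
proof -
  interpret M: prob_space \<mu> by (rule prob_\<mu>)
  interpret N: prob_space \<nu> by (rule prob_\<nu>)
  interpret P: pair_prob_space \<mu> \<nu> ..
  have sp: "space \<mu> = UNIV" "space \<nu> = UNIV"
    using sets_eq_imp_space_eq[OF sets_\<mu>] sets_eq_imp_space_eq[OF sets_\<nu>] by auto
  have "\<mu> \<Otimes>\<^sub>M \<nu> \<in> transport_plans \<mu> \<nu>"
  proof (rule transport_plansI)
    show "sets (\<mu> \<Otimes>\<^sub>M \<nu>) = sets borel"
      using sets_\<mu> sets_\<nu> by (simp add: borel_prod[symmetric] cong: sets_pair_measure_cong)
    show "emeasure (\<mu> \<Otimes>\<^sub>M \<nu>) (A \<times> UNIV) = emeasure \<mu> A" if "A \<in> sets borel" for A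
      using N.emeasure_pair_measure_Times[of A \<mu> UNIV] that sets_\<mu> sets_\<nu> N.emeasure_space_1 sp by simp
    show "emeasure (\<mu> \<Otimes>\<^sub>M \<nu>) (UNIV \<times> B) = emeasure \<nu> B" if "B \<in> sets borel" for B
      using N.emeasure_pair_measure_Times[of UNIV \<mu> B] that sets_\<mu> sets_\<nu> M.emeasure_space_1 sp by simp
  qed
  then show ?thesis by blast
qed

end

text \<open>
  As a pointwise limit of the measures \<open>\<gamma> n\<close> on all sets at once, \<open>L\<close> inherits monotonicity and
  finite additivity on Borel sets, and the marginals.
\<close>

locale plan_sequence = compact_marginals \<mu> \<nu>
  for \<mu> :: "'a::{t2_space, second_countable_topology} measure"
    and \<nu> :: "'b::{t2_space, second_countable_topology} measure" +
  fixes \<gamma> :: "nat \<Rightarrow> ('a \<times> 'b) measure" and F :: "nat filter" and L :: "('a \<times> 'b) set \<Rightarrow> real"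
  assumes plans: "\<And>n. \<gamma> n \<in> transport_plans \<mu> \<nu>" and F: "F \<noteq> bot"
    and L: "\<And>R. ((\<lambda>n. measure (\<gamma> n) R) \<longlongrightarrow> L R) F"
begin

lemma plan_finite: "finite_measure (\<gamma> n)"
  using plan_prob_space[OF plans] prob_space.finite_measure by blast

lemma in_plan_sets: "R \<in> sets borel \<Longrightarrow> R \<in> sets (\<gamma> n)"
  using plan_sets[OF plans] by simp

lemma L_eq: "(\<And>n. measure (\<gamma> n) R = r) \<Longrightarrow> L R = r"
  using L[of R] by (simp add: tendsto_const_iff[OF F])

lemma L_nonneg: "0 \<le> L R"
  by (rule tendsto_lowerbound[OF L _ F]) simp

lemma L_empty: "L {} = 0"
  by (rule L_eq) simp

lemma L_mono: "R \<subseteq> S \<Longrightarrow> S \<in> sets borel \<Longrightarrow> L R \<le> L S"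
  by (rule tendsto_le[OF F L L])
    (auto intro!: always_eventually finite_measure.finite_measure_mono[OF plan_finite] in_plan_sets)

lemma L_Un_disjoint:
  assumes "R \<in> sets borel" "S \<in> sets borel" "R \<inter> S = {}"
  shows "L (R \<union> S) = L R + L S"
proof -
  have "((\<lambda>n. measure (\<gamma> n) (R \<union> S)) \<longlongrightarrow> L R + L S) F"
    using tendsto_add[OF L L] assms
    by (simp add: finite_measure.finite_measure_Union[OF plan_finite in_plan_sets in_plan_sets])
  then show ?thesis using tendsto_unique[OF F L] by blast
qed

lemma L_Un_le:
  assumes "R \<in> sets borel" "S \<in> sets borel"
  shows "L (R \<union> S) \<le> L R + L S"
  using L_Un_disjoint[of R "S - R"] L_mono[of "S - R" S] assms by (auto simp: Un_Diff_cancel)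

lemma L_UN_le:
  assumes "\<And>i. R i \<in> sets borel"
  shows "L (\<Union>i\<le>(n::nat). R i) \<le> (\<Sum>i\<le>n. L (R i))"
proof (induction n)
  case (Suc n)
  have "(\<Union>i\<le>Suc n. R i) = (\<Union>i\<le>n. R i) \<union> R (Suc n)" by (auto simp: atMost_Suc)
  moreover have "(\<Union>i\<le>n. R i) \<in> sets borel" using assms by auto
  ultimately show ?case using L_Un_le[of "\<Union>i\<le>n. R i" "R (Suc n)"] assms Suc by simp
qed simp

text \<open>
  These sets form an algebra already because \<open>L\<close> is finitely additive. They are chosen so that
  compactness can make up for the missing countable additivity.
\<close>

definition regular_sets :: "('a \<times> 'b) set set" where
  "regular_sets = {R \<in> sets borel. \<forall>e>0. \<exists>K U. closed K \<and> open U \<and> K \<subseteq> R \<and> R \<subseteq> U \<and> L (U - K) < e}"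

lemma regular_sets_borel: "R \<in> regular_sets \<Longrightarrow> R \<in> sets borel"
  by (simp add: regular_sets_def)

lemma regular_setsE:
  assumes "R \<in> regular_sets" "e > 0"
  obtains K U where "closed K" "open U" "K \<subseteq> R" "R \<subseteq> U" "L (U - K) < e"
  using assms unfolding regular_sets_def by blast

lemma regular_sets_algebra: "algebra UNIV regular_sets"
  unfolding algebra_iff_Un
proof (intro conjI ballI)
  show "regular_sets \<subseteq> Pow UNIV" by simp
  show "{} \<in> regular_sets"
    unfolding regular_sets_def by (auto intro!: exI[of _ "{}"] simp: L_empty)
  show "UNIV - R \<in> regular_sets" if R: "R \<in> regular_sets" for R
    unfolding regular_sets_def
  proof (intro CollectI conjI allI impI)
    show "UNIV - R \<in> sets borel" using regular_sets_borel[OF R] by simp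
    fix e :: real assume "e > 0"
    then obtain K U where "closed K" "open U" "K \<subseteq> R" "R \<subseteq> U" "L (U - K) < e"
      by (rule regular_setsE[OF R])
    moreover have "- K - - U = U - K" by auto
    ultimately show "\<exists>K U. closed K \<and> open U \<and> K \<subseteq> UNIV - R \<and> UNIV - R \<subseteq> U \<and> L (U - K) < e"
      by (intro exI[of _ "- U"] exI[of _ "- K"]) auto
  qed
  show "R \<union> S \<in> regular_sets" if R: "R \<in> regular_sets" and S: "S \<in> regular_sets" for R S
    unfolding regular_sets_def
  proof (intro CollectI conjI allI impI)
    show "R \<union> S \<in> sets borel" using regular_sets_borel R S by simp
    fix e :: real assume "e > 0"
    then have e: "e / 2 > 0" by simp
    obtain K U where KU: "closed K" "open U" "K \<subseteq> R" "R \<subseteq> U" "L (U - K) < e / 2"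
      using regular_setsE[OF R e] .
    obtain K' U' where KU': "closed K'" "open U'" "K' \<subseteq> S" "S \<subseteq> U'" "L (U' - K') < e / 2"
      using regular_setsE[OF S e] .
    have "L ((U \<union> U') - (K \<union> K')) \<le> L ((U - K) \<union> (U' - K'))"
      using KU KU' by (intro L_mono) auto
    also have "\<dots> \<le> L (U - K) + L (U' - K')" using KU KU' by (intro L_Un_le) auto
    also have "\<dots> < e" using KU(5) KU'(5) by simp
    finally show "\<exists>K U. closed K \<and> open U \<and> K \<subseteq> R \<union> S \<and> R \<union> S \<subseteq> U \<and> L (U - K) < e"
      using KU KU' by (intro exI[of _ "K \<union> K'"] exI[of _ "U \<union> U'"]) auto
  qed
qed

text \<open>
  \<open>L\<close> has the marginals \<open>\<mu>\<close> and \<open>\<nu>\<close>, and these are regular, so strips are regular; a rectangle is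
  the intersection of two strips.
\<close>

lemma rect_regular:
  assumes "A \<in> sets borel" "B \<in> sets borel"
  shows "A \<times> B \<in> regular_sets"
proof -
  interpret algebra UNIV regular_sets by (rule regular_sets_algebra)
  have "A \<times> UNIV \<in> regular_sets"
    unfolding regular_sets_def
  proof (intro CollectI conjI allI impI)
    show "A \<times> (UNIV :: 'b set) \<in> sets borel" by (rule rect_borel[OF assms(1)]) simp
    fix e :: real assume "e > 0"
    then obtain K U where KU: "closed K" "open U" "K \<subseteq> A" "A \<subseteq> U" "measure \<mu> (U - K) < e"
      using regular_Borel_measure[OF compact_a _ sets_\<mu> assms(1)] prob_space.finite_measure[OF prob_\<mu>] by blast
    have "L ((U - K) \<times> UNIV) = measure \<mu> (U - K)"
      using KU by (intro L_eq plan_marginal_fst plans) auto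
    moreover have "(U - K) \<times> (UNIV :: 'b set) = U \<times> UNIV - K \<times> UNIV" by auto
    ultimately have "L (U \<times> UNIV - K \<times> UNIV) < e" using KU(5) by simp
    moreover have "closed (K \<times> UNIV)" "open (U \<times> UNIV)" "K \<times> UNIV \<subseteq> A \<times> (UNIV :: 'b set)" "A \<times> (UNIV :: 'b set) \<subseteq> U \<times> UNIV"
      using KU by (auto intro: closed_Times open_Times)
    ultimately show "\<exists>K U. closed K \<and> open U \<and> K \<subseteq> A \<times> (UNIV :: 'b set) \<and> A \<times> (UNIV :: 'b set) \<subseteq> U \<and> L (U - K) < e"
      by blast
  qed
  moreover have "UNIV \<times> B \<in> regular_sets"
    unfolding regular_sets_def
  proof (intro CollectI conjI allI impI)
    show "(UNIV :: 'a set) \<times> B \<in> sets borel" by (rule rect_borel[OF _ assms(2)]) simp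
    fix e :: real assume "e > 0"
    then obtain K U where KU: "closed K" "open U" "K \<subseteq> B" "B \<subseteq> U" "measure \<nu> (U - K) < e"
      using regular_Borel_measure[OF compact_b _ sets_\<nu> assms(2)] prob_space.finite_measure[OF prob_\<nu>] by blast
    have "L (UNIV \<times> (U - K)) = measure \<nu> (U - K)"
      using KU by (intro L_eq plan_marginal_snd plans) auto
    moreover have "(UNIV :: 'a set) \<times> (U - K) = UNIV \<times> U - UNIV \<times> K" by auto
    ultimately have "L (UNIV \<times> U - UNIV \<times> K) < e" using KU(5) by simp
    moreover have "closed (UNIV \<times> K)" "open (UNIV \<times> U)" "UNIV \<times> K \<subseteq> (UNIV :: 'a set) \<times> B" "(UNIV :: 'a set) \<times> B \<subseteq> UNIV \<times> U"
      using KU by (auto intro: closed_Times open_Times)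
    ultimately show "\<exists>K U. closed K \<and> open U \<and> K \<subseteq> (UNIV :: 'a set) \<times> B \<and> (UNIV :: 'a set) \<times> B \<subseteq> U \<and> L (U - K) < e"
      by blast
  qed
  moreover have "A \<times> B = (A \<times> UNIV) \<inter> (UNIV \<times> B)" by auto
  ultimately show ?thesis by auto
qed

text \<open>
  Choose closed sets \<open>K i\<close> inside of \<open>R i\<close> that miss only a small part. Their intersection is empty,
  so by compactness finitely many of them have empty intersection. From then on \<open>R n\<close> is covered
  by the small differences \<open>R i - K i\<close>.
\<close>

lemma L_continuous_at_empty:
  assumes R: "range R \<subseteq> regular_sets" and "decseq R" "(\<Inter>i. R i) = {}"
  shows "(\<lambda>i. L (R i)) \<longlonglongrightarrow> 0"
proof (rule LIMSEQ_I)
  fix e :: real assume e: "e > 0"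
  have Rb: "R i \<in> sets borel" for i using R regular_sets_borel by auto
  have "\<exists>K. closed K \<and> K \<subseteq> R i \<and> L (R i - K) < e / 2 * (1 / 2) ^ Suc i" for i
  proof -
    obtain K U where KU: "closed K" "open U" "K \<subseteq> R i" "R i \<subseteq> U" "L (U - K) < e / 2 * (1 / 2) ^ Suc i"
      by (rule regular_setsE[of "R i" "e / 2 * (1 / 2) ^ Suc i"]) (use R e in auto)
    have "L (R i - K) \<le> L (U - K)" using KU by (intro L_mono) auto
    then show ?thesis using KU by (intro exI[of _ K]) auto
  qed
  then obtain K where K: "\<And>i. closed (K i)" "\<And>i. K i \<subseteq> R i"
    "\<And>i. L (R i - K i) < e / 2 * (1 / 2) ^ Suc i" by metis
  have "\<exists>n. (\<Inter>i\<le>n. K i) = {}"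
  proof (rule ccontr)
    assume ne: "\<not> ?thesis"
    have "UNIV \<inter> (\<Inter>i. K i) \<noteq> {}"
    proof (rule compact_imp_fip_image[OF compact_prod])
      fix I :: "nat set" assume "finite I"
      then obtain n where "I \<subseteq> {..n}" using finite_nat_iff_bounded_le by blast
      then have "(\<Inter>i\<le>n. K i) \<subseteq> (\<Inter>i\<in>I. K i)" by (rule INT_anti_mono) simp
      moreover have "(\<Inter>i\<le>n. K i) \<noteq> {}" using ne by simp
      ultimately show "UNIV \<inter> (\<Inter>i\<in>I. K i) \<noteq> {}" by auto
    qed (use K(1) in auto)
    moreover have "(\<Inter>i. K i) \<subseteq> (\<Inter>i. R i)" by (rule INT_anti_mono) (use K(2) in auto)
    ultimately show False using assms(3) by simp
  qed
  then obtain n where n: "(\<Inter>i\<le>n. K i) = {}" ..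
  have s: "(\<lambda>i. e / 2 * (1 / 2) ^ Suc i) sums (e / 2)"
    using sums_mult[OF power_half_series, of "e / 2"] by simp
  have "L (R n) \<le> L (\<Union>i\<le>n. R i - K i)"
  proof (rule L_mono)
    show "R n \<subseteq> (\<Union>i\<le>n. R i - K i)"
    proof
      fix z assume z: "z \<in> R n"
      obtain i where "i \<le> n" "z \<notin> K i" using n by auto
      moreover have "R n \<subseteq> R i" by (rule decseqD[OF \<open>decseq R\<close> \<open>i \<le> n\<close>])
      ultimately show "z \<in> (\<Union>i\<le>n. R i - K i)" using z by auto
    qed
  qed (use Rb K(1) in auto)
  also have "\<dots> \<le> (\<Sum>i\<le>n. L (R i - K i))" by (rule L_UN_le) (use Rb K(1) in auto)
  also have "\<dots> \<le> (\<Sum>i\<le>n. e / 2 * (1 / 2) ^ Suc i)" using K(3) by (intro sum_mono less_imp_le)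
  also have "\<dots> \<le> (\<Sum>i. e / 2 * (1 / 2) ^ Suc i)"
    using e by (intro sum_le_suminf[OF sums_summable[OF s] finite_atMost] mult_nonneg_nonneg zero_le_power) simp_all
  also have "\<dots> = e / 2" using sums_unique[OF s] by simp
  finally have "L (R n) < e" using e by simp
  moreover have "L (R m) \<le> L (R n)" if "m \<ge> n" for m
    by (rule L_mono[OF decseqD[OF \<open>decseq R\<close> that] Rb])
  ultimately show "\<exists>n. \<forall>m\<ge>n. norm (L (R m) - 0) < e"
    by (intro exI[of _ n] allI impI) (auto simp: abs_of_nonneg[OF L_nonneg] intro: le_less_trans)
qed

lemma limit_plan:
  obtains \<gamma>' where "\<gamma>' \<in> transport_plans \<mu> \<nu>" "\<And>R. R \<in> regular_sets \<Longrightarrow> measure \<gamma>' R = L R"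
proof -
  interpret algebra UNIV regular_sets by (rule regular_sets_algebra)
  have "\<exists>m. (\<forall>s\<in>regular_sets. m s = ennreal (L s)) \<and> measure_space UNIV (sigma_sets UNIV regular_sets) m"
  proof (rule caratheodory_empty_continuous)
    show "positive regular_sets (\<lambda>R. ennreal (L R))" by (simp add: positive_def L_empty)
    show "additive regular_sets (\<lambda>R. ennreal (L R))"
      by (auto simp: additive_def L_Un_disjoint regular_sets_borel ennreal_plus L_nonneg)
    show "(\<lambda>i. ennreal (L (R i))) \<longlonglongrightarrow> 0" if "range R \<subseteq> regular_sets" "decseq R" "(\<Inter>i. R i) = {}" for R
      using tendsto_ennrealI[OF L_continuous_at_empty[OF that]] by simp
  qed simp
  then obtain m where m: "\<And>R. R \<in> regular_sets \<Longrightarrow> m R = ennreal (L R)"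
    "measure_space UNIV (sigma_sets UNIV regular_sets) m" by blast
  define \<gamma>' where "\<gamma>' = measure_of UNIV (sigma_sets UNIV regular_sets) m"
  have "sigma_sets UNIV regular_sets = sets borel"
  proof (rule equalityI)
    show "sigma_sets UNIV regular_sets \<subseteq> sets borel"
      using sets.sigma_sets_subset[of regular_sets borel] regular_sets_borel by auto
    have "sets borel = sigma_sets UNIV {A \<times> B | A B. A \<in> sets (borel :: 'a measure) \<and> B \<in> sets (borel :: 'b measure)}"
      unfolding borel_prod[symmetric] sets_pair_measure by simp
    also have "\<dots> \<subseteq> sigma_sets UNIV regular_sets"
      by (rule sigma_sets_mono') (auto intro: rect_regular)
    finally show "sets borel \<subseteq> sigma_sets UNIV regular_sets" .
  qed
  moreover have "sets \<gamma>' = sigma_sets UNIV regular_sets"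
    unfolding \<gamma>'_def by (simp add: sets_measure_of sigma_sets_sigma_sets_eq)
  ultimately have sets: "sets \<gamma>' = sets borel" by simp
  have em: "emeasure \<gamma>' R = ennreal (L R)" if "R \<in> regular_sets" for R
    unfolding \<gamma>'_def using m that
    by (subst emeasure_measure_of_sigma) (auto simp: measure_space_def)
  have "\<gamma>' \<in> transport_plans \<mu> \<nu>"
  proof (rule transport_plansI[OF sets])
    interpret M: prob_space \<mu> by (rule prob_\<mu>)
    interpret N: prob_space \<nu> by (rule prob_\<nu>)
    show "emeasure \<gamma>' (A \<times> UNIV) = emeasure \<mu> A" if "A \<in> sets borel" for A
      using that L_eq[OF plan_marginal_fst[OF plans that]]
      by (simp add: em rect_regular M.emeasure_eq_measure)
    show "emeasure \<gamma>' (UNIV \<times> B) = emeasure \<nu> B" if "B \<in> sets borel" for B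
      using that L_eq[OF plan_marginal_snd[OF plans that]]
      by (simp add: em rect_regular N.emeasure_eq_measure)
  qed
  then show ?thesis
    using em L_nonneg by (intro that[of \<gamma>']) (auto simp: measure_def)
qed

text \<open>
  Convergence is known for the measures of regular sets only, so \<open>c\<close> is approximated by a step
  function on regular sets: by compactness finitely many open rectangles on which \<open>c\<close> varies by at
  most \<open>e\<close> cover the product, and they are made disjoint one at a time.
\<close>

lemma rect_simple_approximation:
  fixes c :: "'a \<times> 'b \<Rightarrow> real"
  assumes "continuous_on UNIV c" "e > 0"
    and \<gamma>': "\<gamma>' \<in> transport_plans \<mu> \<nu>" "\<And>R. R \<in> regular_sets \<Longrightarrow> measure \<gamma>' R = L R"
  obtains s where "\<And>\<eta>. \<eta> \<in> transport_plans \<mu> \<nu> \<Longrightarrow> integrable \<eta> s"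
    "((\<lambda>n. \<integral>z. s z \<partial>\<gamma> n) \<longlongrightarrow> (\<integral>z. s z \<partial>\<gamma>')) F" "\<And>z. \<bar>c z - s z\<bar> \<le> e"
proof -
  interpret algebra UNIV regular_sets by (rule regular_sets_algebra)
  let ?W = "{W \<in> regular_sets. open W \<and> (\<exists>a. \<forall>z\<in>W. \<bar>c z - a\<bar> \<le> e)}"
  have "UNIV \<subseteq> \<Union>?W"
  proof
    fix z
    have "open (c -` ball (c z) e)"
      using continuous_open_preimage[OF assms(1) open_UNIV open_ball] by simp
    moreover have "z \<in> c -` ball (c z) e" using assms(2) by simp
    ultimately obtain U V where "open U" "open V" "z \<in> U \<times> V" "U \<times> V \<subseteq> c -` ball (c z) e"
      by (rule open_prod_elim)
    then show "z \<in> \<Union>?W"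
      by (intro UnionI[of "U \<times> V"])
        (auto intro!: rect_regular open_Times exI[of _ "c z"] simp: dist_real_def subset_iff less_imp_le abs_minus_commute)
  qed
  then obtain D where D: "D \<subseteq> ?W" "finite D" "UNIV \<subseteq> \<Union>D"
    using compactE[OF compact_prod, of ?W] by (metis (mono_tags, lifting) mem_Collect_eq)
  from D(2,1) have "\<exists>s. (\<forall>\<eta>\<in>transport_plans \<mu> \<nu>. integrable \<eta> s) \<and>
      ((\<lambda>n. \<integral>z. s z \<partial>\<gamma> n) \<longlongrightarrow> (\<integral>z. s z \<partial>\<gamma>')) F \<and>
      (\<forall>z\<in>\<Union>D. \<bar>c z - s z\<bar> \<le> e) \<and> (\<forall>z. z \<notin> \<Union>D \<longrightarrow> s z = 0)"
  proof (induction D)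
    case empty
    then show ?case by (intro exI[of _ "\<lambda>_. 0"]) simp
  next
    case (insert W D)
    then obtain s where s: "\<And>\<eta>. \<eta> \<in> transport_plans \<mu> \<nu> \<Longrightarrow> integrable \<eta> s"
      "((\<lambda>n. \<integral>z. s z \<partial>\<gamma> n) \<longlongrightarrow> (\<integral>z. s z \<partial>\<gamma>')) F"
      "\<forall>z\<in>\<Union>D. \<bar>c z - s z\<bar> \<le> e" "\<forall>z. z \<notin> \<Union>D \<longrightarrow> s z = 0" by auto
    obtain a where a: "\<forall>z\<in>W. \<bar>c z - a\<bar> \<le> e" using insert by auto
    \<comment> \<open>The new value is used only where no earlier rectangle has fixed one.\<close>
    let ?R = "W - \<Union>D"
    let ?s = "\<lambda>z. s z + a * indicator ?R z"
    have "\<Union>D \<in> regular_sets" using insert by (intro finite_Union) auto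
    then have R: "?R \<in> regular_sets" using insert by auto
    have ind: "integrable \<eta> (\<lambda>z. a * indicator ?R z)" if "\<eta> \<in> transport_plans \<mu> \<nu>" for \<eta>
    proof (rule plan_integrable[OF that])
      show "(\<lambda>z. a * indicator ?R z) \<in> borel_measurable borel"
        using regular_sets_borel[OF R] by (intro borel_measurable_times borel_measurable_const borel_measurable_indicator)
      show "\<bar>a * indicator ?R z\<bar> \<le> \<bar>a\<bar>" for z by (simp add: indicator_def)
    qed
    have int: "(\<integral>z. ?s z \<partial>\<eta>) = (\<integral>z. s z \<partial>\<eta>) + a * measure \<eta> ?R" if "\<eta> \<in> transport_plans \<mu> \<nu>" for \<eta>
      using Bochner_Integration.integral_add[OF s(1)[OF that] ind[OF that]] plan_space[OF that] by simp
    have "((\<lambda>n. \<integral>z. ?s z \<partial>\<gamma> n) \<longlongrightarrow> (\<integral>z. ?s z \<partial>\<gamma>')) F"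
      unfolding int[OF plans] int[OF \<gamma>'(1)] \<gamma>'(2)[OF R]
      by (intro tendsto_add tendsto_mult_left s(2) L)
    then show ?case
      using s(3,4) a by (intro exI[of _ ?s] conjI ballI allI impI Bochner_Integration.integrable_add s(1) ind)
        (auto simp: indicator_def)
  qed
  then show ?thesis using D(3) that by (metis UNIV_I subsetD)
qed

text \<open>
  A plan has total mass one, so a uniform error in the integrand is an equally large error in all
  the integrals.
\<close>

lemma limit_plan_integral:
  fixes c :: "'a \<times> 'b \<Rightarrow> real"
  assumes "continuous_on UNIV c"
    and \<gamma>': "\<gamma>' \<in> transport_plans \<mu> \<nu>" "\<And>R. R \<in> regular_sets \<Longrightarrow> measure \<gamma>' R = L R"
  shows "((\<lambda>n. \<integral>z. c z \<partial>\<gamma> n) \<longlongrightarrow> (\<integral>z. c z \<partial>\<gamma>')) F"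
proof (rule tendstoI)
  fix e :: real assume "e > 0"
  then have e: "e / 3 > 0" by simp
  obtain s where s: "\<And>\<eta>. \<eta> \<in> transport_plans \<mu> \<nu> \<Longrightarrow> integrable \<eta> s"
    "((\<lambda>n. \<integral>z. s z \<partial>\<gamma> n) \<longlongrightarrow> (\<integral>z. s z \<partial>\<gamma>')) F" "\<And>z. \<bar>c z - s z\<bar> \<le> e / 3"
    using rect_simple_approximation[OF assms(1) e \<gamma>'] by blast
  have close: "\<bar>(\<integral>z. c z \<partial>\<eta>) - (\<integral>z. s z \<partial>\<eta>)\<bar> \<le> e / 3" if \<eta>: "\<eta> \<in> transport_plans \<mu> \<nu>" for \<eta>
  proof -
    interpret prob_space \<eta> by (rule plan_prob_space[OF \<eta>])
    have "\<bar>\<integral>z. c z - s z \<partial>\<eta>\<bar> \<le> (\<integral>z. e / 3 \<partial>\<eta>)"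
      by (rule order_trans[OF integral_abs_bound integral_mono])
        (use s(3) plan_integrable_continuous[OF \<eta> assms(1)] s(1)[OF \<eta>] in auto)
    then show ?thesis
      using Bochner_Integration.integral_diff[OF plan_integrable_continuous[OF \<eta> assms(1)] s(1)[OF \<eta>]]
      by (simp add: prob_space)
  qed
  show "\<forall>\<^sub>F n in F. dist (\<integral>z. c z \<partial>\<gamma> n) (\<integral>z. c z \<partial>\<gamma>') < e"
    using tendstoD[OF s(2) e]
  proof (rule eventually_mono)
    fix n assume "dist (\<integral>z. s z \<partial>\<gamma> n) (\<integral>z. s z \<partial>\<gamma>') < e / 3"
    then show "dist (\<integral>z. c z \<partial>\<gamma> n) (\<integral>z. c z \<partial>\<gamma>') < e"
      using close[OF plans[of n]] close[OF \<gamma>'(1)] unfolding dist_real_def by linarith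
  qed
qed

end

context compact_marginals
begin

text \<open>
  The direct method: a minimizing sequence has a cluster point among the plans, and the integral of
  the cost passes to the limit.
\<close>

lemma optimal_plan_exists:
  fixes c :: "'a \<times> 'b \<Rightarrow> real"
  assumes "continuous_on UNIV c"
  obtains \<gamma> where "optimal_plan c \<mu> \<nu> \<gamma>"
proof -
  let ?I = "(\<lambda>\<gamma>. \<integral>z. c z \<partial>\<gamma>) ` transport_plans \<mu> \<nu>"
  obtain C where C: "\<And>z. \<bar>c z\<bar> \<le> C" using continuous_bounded[OF assms] by blast
  have "bdd_below ?I"
  proof (rule bdd_belowI2)
    fix \<gamma> assume \<gamma>: "\<gamma> \<in> transport_plans \<mu> \<nu>"
    interpret prob_space \<gamma> by (rule plan_prob_space[OF \<gamma>])
    have "- C \<le> c z" for z using C[of z] by linarith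
    then show "- C \<le> (\<integral>z. c z \<partial>\<gamma>)"
      by (intro integral_ge_const plan_integrable_continuous[OF \<gamma> assms]) auto
  qed
  then have Inf_le: "Inf ?I \<le> (\<integral>z. c z \<partial>\<gamma>)" if "\<gamma> \<in> transport_plans \<mu> \<nu>" for \<gamma>
    using that by (intro cInf_lower) auto
  have "\<exists>\<gamma>\<in>transport_plans \<mu> \<nu>. (\<integral>z. c z \<partial>\<gamma>) < Inf ?I + 1 / real (Suc n)" for n
    using cInf_lessD[of ?I "Inf ?I + 1 / real (Suc n)"] transport_plans_nonempty by auto
  then obtain \<gamma> where \<gamma>: "\<And>n. \<gamma> n \<in> transport_plans \<mu> \<nu>"
    "\<And>n. (\<integral>z. c z \<partial>\<gamma> n) < Inf ?I + 1 / real (Suc n)" by metis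
  have "measure (\<gamma> n) R \<in> {0..1}" for n R
    using prob_space.prob_le_1[OF plan_prob_space[OF \<gamma>(1)]] by simp
  then obtain F L where FL: "F \<noteq> bot" "F \<le> sequentially" "\<And>R. ((\<lambda>n. measure (\<gamma> n) R) \<longlongrightarrow> L R) F"
    using bounded_functions_cluster_point[of "\<lambda>n R. measure (\<gamma> n) R"] by blast
  interpret plan_sequence \<mu> \<nu> \<gamma> F L
    using \<gamma>(1) FL by unfold_locales auto
  obtain \<gamma>' where \<gamma>': "\<gamma>' \<in> transport_plans \<mu> \<nu>" "\<And>R. R \<in> regular_sets \<Longrightarrow> measure \<gamma>' R = L R"
    using limit_plan by blast
  have "(\<integral>z. c z \<partial>\<gamma>') \<le> Inf ?I"
  proof (rule tendsto_le[OF FL(1)])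
    show "((\<lambda>n. \<integral>z. c z \<partial>\<gamma> n) \<longlongrightarrow> (\<integral>z. c z \<partial>\<gamma>')) F"
      by (rule limit_plan_integral[OF assms \<gamma>'])
    have "(\<lambda>n. Inf ?I + 1 / real (Suc n)) \<longlonglongrightarrow> Inf ?I + 0"
      by (intro tendsto_add tendsto_const LIMSEQ_Suc lim_1_over_n)
    then show "((\<lambda>n. Inf ?I + 1 / real (Suc n)) \<longlongrightarrow> Inf ?I) F"
      using tendsto_mono[OF FL(2)] by simp
    show "\<forall>\<^sub>F n in F. (\<integral>z. c z \<partial>\<gamma> n) \<le> Inf ?I + 1 / real (Suc n)"
      using \<gamma>(2) by (intro always_eventually allI less_imp_le)
  qed
  then show ?thesis
    using \<gamma>'(1) Inf_le by (intro that[of \<gamma>']) (force simp: optimal_plan_def)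
qed

end

section \<open>Countably many smooth functions separate measures\<close>

text \<open>
  Lindelof's theorem, applied to each member of a countable base, picks countably many exhausted sets
  that still generate the topology; their finite intersections are exhausted because \<open>S\<close> is closed
  under products.
\<close>

lemma countable_exhaustible_base:
  fixes S :: "('c::second_countable_topology \<Rightarrow> real) set"
  assumes base: "\<And>G x. open G \<Longrightarrow> x \<in> G \<Longrightarrow>
      \<exists>W g. open W \<and> x \<in> W \<and> W \<subseteq> G \<and> exhausts g W \<and> (\<forall>n. g n \<in> S)"
    and mult: "\<And>f g. f \<in> S \<Longrightarrow> g \<in> S \<Longrightarrow> (\<lambda>x. f x * g x) \<in> S"
    and one: "(\<lambda>x. 1) \<in> S"
  obtains \<W> where "countable \<W>" "UNIV \<in> \<W>" "Int_stable \<W>" "sets borel = sigma_sets UNIV \<W>"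
    "\<And>W. W \<in> \<W> \<Longrightarrow> \<exists>g. exhausts g W \<and> (\<forall>n. g n \<in> S)"
proof -
  let ?V = "{W. open W \<and> (\<exists>g. exhausts g W \<and> (\<forall>n. g n \<in> S))}"
  obtain B :: "'c set set" where B: "countable B" "\<And>G. G \<in> B \<Longrightarrow> open G"
    "\<And>G. open G \<Longrightarrow> \<exists>U. U \<subseteq> B \<and> G = \<Union>U"
    by (rule univ_second_countable) blast
  have "\<exists>C. C \<subseteq> ?V \<and> countable C \<and> \<Union>C = G" if G: "G \<in> B" for G
  proof -
    let ?V' = "{W \<in> ?V. W \<subseteq> G}"
    obtain C where C: "C \<subseteq> ?V'" "countable C" "\<Union>C = \<Union>?V'"
      by (rule Lindelof[of ?V']) auto
    have "\<Union>?V' = G"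
    proof (intro equalityI subsetI)
      fix x assume "x \<in> G"
      then obtain W g where "open W" "x \<in> W" "W \<subseteq> G" "exhausts g W" "\<forall>n. g n \<in> S"
        using base[OF B(2)[OF G]] by blast
      then show "x \<in> \<Union>?V'" by (intro UnionI[of W]) auto
    qed auto
    then show ?thesis using C by (intro exI[of _ C]) auto
  qed
  then have "\<forall>G\<in>B. \<exists>C. C \<subseteq> ?V \<and> countable C \<and> \<Union>C = G" by blast
  from bchoice[OF this] obtain C where "\<forall>G\<in>B. C G \<subseteq> ?V \<and> countable (C G) \<and> \<Union>(C G) = G" ..
  then have C: "\<And>G. G \<in> B \<Longrightarrow> C G \<subseteq> ?V" "\<And>G. G \<in> B \<Longrightarrow> countable (C G)"
    "\<And>G. G \<in> B \<Longrightarrow> \<Union>(C G) = G" by simp_all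
  define V where "V = (\<Union>G\<in>B. C G)"
  define \<W> where "\<W> = Inter ` {T. finite T \<and> T \<subseteq> V}"
  have V: "countable V" "V \<subseteq> ?V" using B(1) C by (auto simp: V_def)
  have \<W>V: "\<Inter>T \<in> ?V" if "finite T" "T \<subseteq> V" for T
    using that
  proof (induction T)
    case empty
    have "exhausts (\<lambda>n x. 1) (UNIV :: 'c set)" by (simp add: exhausts_def)
    then show ?case using one by auto
  next
    case (insert W T)
    then obtain g h where "open W" "exhausts g W" "\<forall>n. g n \<in> S"
      "open (\<Inter>T)" "exhausts h (\<Inter>T)" "\<forall>n. h n \<in> S" using V(2) by auto
    then show ?case
      using exhausts_Int[of g W h "\<Inter>T"] mult
      by (auto intro!: exI[of _ "\<lambda>n x. g n x * h n x"])
  qed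
  show ?thesis
  proof (rule that)
    show "countable \<W>" unfolding \<W>_def by (intro countable_image countable_Collect_finite_subset V)
    show "UNIV \<in> \<W>" unfolding \<W>_def by (rule image_eqI[of _ _ "{}"]) auto
    show "Int_stable \<W>"
    proof (rule Int_stableI)
      fix W W' assume "W \<in> \<W>" "W' \<in> \<W>"
      then obtain T T' where "finite T" "T \<subseteq> V" "W = \<Inter>T" "finite T'" "T' \<subseteq> V" "W' = \<Inter>T'"
        unfolding \<W>_def by auto
      then show "W \<inter> W' \<in> \<W>" unfolding \<W>_def by (intro image_eqI[of _ _ "T \<union> T'"]) auto
    qed
    show "\<exists>g. exhausts g W \<and> (\<forall>n. g n \<in> S)" if "W \<in> \<W>" for W
      using that \<W>V unfolding \<W>_def by auto
    have "sigma_sets UNIV {G :: 'c set. open G} = sigma_sets UNIV \<W>"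
    proof (rule sigma_sets_eqI)
      fix G :: "'c set" assume "G \<in> {G. open G}"
      then obtain U where U: "U \<subseteq> B" "G = \<Union>U" using B(3) by auto
      have V\<W>: "W \<in> \<W>" if "W \<in> V" for W
        unfolding \<W>_def using that by (intro image_eqI[of _ _ "{W}"]) auto
      have "H \<in> sigma_sets UNIV \<W>" if "H \<in> B" for H
      proof -
        have "\<Union>(C H) \<in> sigma_sets UNIV \<W>"
          using that C(2) V\<W> by (intro sigma_sets_UNION) (auto simp: V_def)
        then show ?thesis using C(3)[OF that] by simp
      qed
      then show "G \<in> sigma_sets UNIV \<W>"
        unfolding U(2) using U(1) countable_subset[OF U(1) B(1)] by (intro sigma_sets_UNION) auto
    next
      fix W assume "W \<in> \<W>"
      then have "open W" using \<W>V unfolding \<W>_def by auto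
      then show "W \<in> sigma_sets UNIV {G. open G}" by auto
    qed
    then show "sets borel = sigma_sets UNIV \<W>" by (simp add: borel_def)
  qed
qed

lemma exhausts_integral_tendsto:
  assumes "prob_space M" "exhausts g W" "W \<in> sets M" "\<And>n. g n \<in> borel_measurable M"
  shows "(\<lambda>n. \<integral>x. g n x \<partial>M) \<longlonglongrightarrow> measure M W"
proof -
  interpret prob_space M by fact
  have "(\<lambda>n. \<integral>x. g n x \<partial>M) \<longlonglongrightarrow> (\<integral>x. indicator W x \<partial>M)"
    using assms by (intro integral_dominated_convergence[where w = "\<lambda>_. 1"]) (auto simp: exhausts_def)
  then show ?thesis using assms(3) by simp
qed

text \<open>
  By dominated convergence the integrals of an exhausting sequence determine the measure of the
  exhausted set, and two finite measures that agree on an intersection-stable generator are equal.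
\<close>

lemma countable_separating_family:
  fixes S :: "('c::second_countable_topology \<Rightarrow> real) set"
  assumes base: "\<And>G x. open G \<Longrightarrow> x \<in> G \<Longrightarrow>
      \<exists>W g. open W \<and> x \<in> W \<and> W \<subseteq> G \<and> exhausts g W \<and> (\<forall>n. g n \<in> S)"
    and mult: "\<And>f g. f \<in> S \<Longrightarrow> g \<in> S \<Longrightarrow> (\<lambda>x. f x * g x) \<in> S"
    and one: "(\<lambda>x. 1) \<in> S"
    and cont: "\<And>f. f \<in> S \<Longrightarrow> continuous_on UNIV f"
  obtains F where "countable F" "F \<subseteq> S"
    "\<And>M N. prob_space M \<Longrightarrow> prob_space N \<Longrightarrow> sets M = sets borel \<Longrightarrow> sets N = sets borel \<Longrightarrow>
       (\<And>f. f \<in> F \<Longrightarrow> (\<integral>x. f x \<partial>M) = (\<integral>x. f x \<partial>N)) \<Longrightarrow> M = N"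
proof -
  obtain \<W> where \<W>: "countable \<W>" "UNIV \<in> \<W>" "Int_stable \<W>" "sets borel = sigma_sets UNIV \<W>"
    "\<And>W. W \<in> \<W> \<Longrightarrow> \<exists>g. exhausts g W \<and> (\<forall>n. g n \<in> S)"
    using countable_exhaustible_base[OF base mult one] by blast
  obtain g where g: "\<And>W. W \<in> \<W> \<Longrightarrow> exhausts (g W) W" "\<And>W n. W \<in> \<W> \<Longrightarrow> g W n \<in> S"
    using \<W>(5) by metis
  show ?thesis
  proof (rule that)
    show "countable (\<Union>W\<in>\<W>. range (g W))" using \<W>(1) by auto
    show "(\<Union>W\<in>\<W>. range (g W)) \<subseteq> S" using g(2) by auto
    fix M N :: "'c measure"
    assume M: "prob_space M" "sets M = sets borel" and N: "prob_space N" "sets N = sets borel"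
      and eq: "\<And>f. f \<in> (\<Union>W\<in>\<W>. range (g W)) \<Longrightarrow> (\<integral>x. f x \<partial>M) = (\<integral>x. f x \<partial>N)"
    have meas: "g W n \<in> borel_measurable M" "g W n \<in> borel_measurable N" if "W \<in> \<W>" for W n
      unfolding measurable_cong_sets[OF M(2) refl] measurable_cong_sets[OF N(2) refl]
      using borel_measurable_continuous_onI[OF cont[OF g(2)[OF that]]] by auto
    have \<W>_sets: "W \<in> sets M" "W \<in> sets N" if "W \<in> \<W>" for W
      using that M(2) N(2) \<W>(4) by auto
    have "measure M W = measure N W" if W: "W \<in> \<W>" for W
    proof (rule LIMSEQ_unique)
      show "(\<lambda>n. \<integral>x. g W n x \<partial>M) \<longlonglongrightarrow> measure M W"
        by (rule exhausts_integral_tendsto[OF M(1) g(1)[OF W] \<W>_sets(1)[OF W] meas(1)[OF W]])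
      have "(\<integral>x. g W n x \<partial>M) = (\<integral>x. g W n x \<partial>N)" for n using W by (intro eq) auto
      then show "(\<lambda>n. \<integral>x. g W n x \<partial>M) \<longlonglongrightarrow> measure N W"
        using exhausts_integral_tendsto[OF N(1) g(1)[OF W] \<W>_sets(2)[OF W] meas(2)[OF W]] by simp
    qed
    then have em: "emeasure M W = emeasure N W" if "W \<in> \<W>" for W
      using that M(1) N(1) finite_measure.emeasure_eq_measure[OF prob_space.finite_measure] by metis
    show "M = N"
    proof (rule measure_eqI_generator_eq[where A = "\<lambda>_. UNIV"])
      show "emeasure M UNIV \<noteq> \<infinity>" for i :: nat
        using finite_measure.emeasure_finite[OF prob_space.finite_measure[OF M(1)]] by simp
    qed (use \<W> M N em in auto)
  qed
qed

section \<open>The \<open>C\<^sup>k\<close> topology\<close>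

text \<open>What the topology of \<open>C\<^sup>k\<close> functions uses of an atlas.\<close>

locale chart_cover =
  fixes A :: "('c::{t2_space, second_countable_topology}, 'e::euclidean_space) chart set" and k :: enat
  assumes charts: "\<And>C. C \<in> A \<Longrightarrow> is_chart C" and cover: "(\<Union>C\<in>A. fst C) = UNIV"
begin

lemma chart_at:
  obtains U \<phi> where "(U, \<phi>) \<in> A" "z \<in> U" "is_chart (U, \<phi>)"
  using cover charts by (metis UNIV_I UN_iff prod.collapse)

lemma A_nonempty: "A \<noteq> {}"
  using cover by auto

lemma Ck_functions_continuous:
  assumes "f \<in> Ck_functions A k"
  shows "continuous_on UNIV f"
proof (rule continuous_at_imp_continuous_on, rule ballI)
  fix z
  obtain U \<phi> where U: "(U, \<phi>) \<in> A" "z \<in> U" "is_chart (U, \<phi>)" by (rule chart_at)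
  note ch = is_chartD[OF U(3)]
  have "continuous_on (\<phi> ` U) (\<lambda>x. f (inv_into U \<phi> x))"
    using assms U(1) by (auto simp: Ck_functions_iff intro: Ck_on_imp_continuous_on)
  then have "continuous_on U (\<lambda>z. f (inv_into U \<phi> (\<phi> z)))"
    by (rule continuous_on_compose2[OF _ ch(3)]) auto
  then have "continuous_on U f"
    by (rule continuous_on_cong[THEN iffD1, rotated 2]) (use ch(5) in auto)
  then show "isCont f z" using ch(1) U(2) by (simp add: continuous_on_eq_continuous_at)
qed

lemma Ck_functions_add_scaled:
  assumes "f \<in> Ck_functions A k" "g \<in> Ck_functions A k"
  shows "(\<lambda>z. f z + t * g z) \<in> Ck_functions A k"
  unfolding Ck_functions_iff
proof (intro allI impI)
  fix U \<phi> assume U: "(U, \<phi>) \<in> A"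
  have o: "open (\<phi> ` U)" by (rule is_chartD(2)[OF charts[OF U]])
  show "Ck_on k (\<lambda>x. f (inv_into U \<phi> x) + t * g (inv_into U \<phi> x)) (\<phi> ` U)"
    unfolding Ck_on_iff_finite_order[of k]
  proof (intro allI impI Ck_on_add[OF o] Ck_on_linear_comp[OF o bounded_linear_mult_right])
    fix n assume n: "enat n \<le> k"
    show "Ck_on (enat n) (\<lambda>x. f (inv_into U \<phi> x)) (\<phi> ` U)"
      "Ck_on (enat n) (\<lambda>x. g (inv_into U \<phi> x)) (\<phi> ` U)"
      using assms U Ck_on_mono[OF _ n] unfolding Ck_functions_iff by blast+
  qed
qed

text \<open>
  Finitely many compact chart balls cover the space, and on each of them the value of a function is
  its iterated derivative of order zero.
\<close>

lemma Ck_topology_sup_nbhd: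
  assumes "compact (UNIV :: 'c set)" "c \<in> Ck_functions A k" "\<delta> > 0"
  obtains T where "openin (Ck_topology A k) T" "c \<in> T" "\<And>g z. g \<in> T \<Longrightarrow> \<bar>g z - c z\<bar> < \<delta>"
proof -
  have "\<exists>V N. open V \<and> z \<in> V \<and> openin (Ck_topology A k) N \<and> c \<in> N \<and>
      (\<forall>g\<in>N. \<forall>y\<in>V. \<bar>g y - c y\<bar> < \<delta>)" for z
  proof -
    obtain U \<phi> where U: "(U, \<phi>) \<in> A" "z \<in> U" "is_chart (U, \<phi>)" by (rule chart_at)
    obtain r where r: "r > 0" "cball (\<phi> z) r \<subseteq> \<phi> ` (U \<inter> UNIV)"
      by (rule chart_ball_exists[OF U(3) open_UNIV UNIV_I U(2)])
    let ?V = "{y \<in> U. \<phi> y \<in> ball (\<phi> z) r}"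
    let ?N = "Ck_nbhd A k (U, \<phi>) (cball (\<phi> z) r) [] \<delta> c"
    have "enat (length ([] :: 'e list)) \<le> k" by (simp add: zero_enat_def[symmetric])
    moreover have "cball (\<phi> z) r \<subseteq> \<phi> ` U" using r(2) by simp
    ultimately have "openin (Ck_topology A k) ?N"
      unfolding Ck_topology_def using U(1) assms(2,3) compact_cball
      by (intro topology_generated_by_Basis) blast
    moreover have "c \<in> ?N" using assms by (simp add: Ck_nbhd_def)
    moreover have "\<bar>g y - c y\<bar> < \<delta>" if g: "g \<in> ?N" and y: "y \<in> ?V" for g y
    proof -
      have "\<phi> y \<in> cball (\<phi> z) r" using y by simp
      then have "\<bar>g (inv_into U \<phi> (\<phi> y)) - c (inv_into U \<phi> (\<phi> y))\<bar> < \<delta>"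
        using g unfolding Ck_nbhd_def by auto
      then show ?thesis using y is_chartD(5)[OF U(3)] by simp
    qed
    moreover have "open ?V" "z \<in> ?V" using chart_ball_open[OF U(3)] U r by auto
    ultimately show ?thesis by blast
  qed
  then obtain V N where VN: "\<And>z. open (V z)" "\<And>z. z \<in> V z" "\<And>z. openin (Ck_topology A k) (N z)"
    "\<And>z. c \<in> N z" "\<And>z g y. g \<in> N z \<Longrightarrow> y \<in> V z \<Longrightarrow> \<bar>g y - c y\<bar> < \<delta>" by metis
  obtain Z where Z: "finite Z" "UNIV \<subseteq> (\<Union>z\<in>Z. V z)"
    by (rule compactE_image[OF assms(1), of UNIV V]) (use VN in auto)
  show ?thesis
  proof (rule that)
    show "openin (Ck_topology A k) ((\<Inter>z\<in>Z. N z) \<inter> topspace (Ck_topology A k))"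
      by (rule openin_INT[OF Z(1) VN(3)])
    show "c \<in> (\<Inter>z\<in>Z. N z) \<inter> topspace (Ck_topology A k)"
      using VN(4) assms(2) topspace_Ck_topology[OF A_nonempty] by auto
    show "\<bar>g z - c z\<bar> < \<delta>" if "g \<in> (\<Inter>z\<in>Z. N z) \<inter> topspace (Ck_topology A k)" for g z
    proof -
      obtain w where "w \<in> Z" "z \<in> V w" using Z(2) by auto
      then show ?thesis using VN(5) that by auto
    qed
  qed
qed

text \<open>
  Only subbasic neighbourhoods matter. There the iterated derivative is affine in \<open>t\<close>, the derivative
  of \<open>f\<close> is bounded on the compact set, and the strict inequality for \<open>c\<close> leaves a positive margin
  because a continuous function attains its maximum.
\<close>

lemma Ck_topology_line:
  assumes f: "f \<in> Ck_functions A k" and c: "c \<in> Ck_functions A k"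
    and T: "openin (Ck_topology A k) T" "c \<in> T"
  obtains d where "d > 0" "\<And>t. \<bar>t\<bar> < d \<Longrightarrow> (\<lambda>z. c z + t * f z) \<in> T"
proof -
  have "\<exists>d>0. \<forall>t. \<bar>t\<bar> < d \<longrightarrow> (\<lambda>z. c z + t * f z) \<in> T"
    using T unfolding Ck_topology_def openin_topology_generated_by_iff
  proof (induction T)
    case (Int S T)
    then obtain d d' where "d > 0" "\<forall>t. \<bar>t\<bar> < d \<longrightarrow> (\<lambda>z. c z + t * f z) \<in> S"
      "d' > 0" "\<forall>t. \<bar>t\<bar> < d' \<longrightarrow> (\<lambda>z. c z + t * f z) \<in> T" by auto
    then show ?case by (intro exI[of _ "min d d'"]) auto
  next
    case (UN K)
    then show ?case by blast
  next
    case (Basis T)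
    then obtain U \<phi> K vs \<epsilon> h where T: "T = Ck_nbhd A k (U, \<phi>) K vs \<epsilon> h" and U: "(U, \<phi>) \<in> A"
      and K: "compact K" "K \<subseteq> \<phi> ` U" and vs: "enat (length vs) \<le> k"
      and \<epsilon>: "\<epsilon> > 0" and h: "h \<in> Ck_functions A k" by blast
    let ?D = "\<lambda>g. iter_deriv vs (\<lambda>y. g (inv_into U \<phi> y))"
    have o: "open (\<phi> ` U)" by (rule is_chartD(2)[OF charts[OF U]])
    have Ck: "Ck_on k (\<lambda>y. g (inv_into U \<phi> y)) (\<phi> ` U)" if "g \<in> Ck_functions A k" for g
      using that U by (simp add: Ck_functions_iff)
    have cont: "continuous_on K (?D g)" if "g \<in> Ck_functions A k" for g
      using Ck[OF that] vs continuous_on_subset[OF _ K(2)] unfolding Ck_on_def by blast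
    have lin: "?D (\<lambda>z. c z + t * f z) x = ?D c x + t * ?D f x" if "x \<in> K" for x t
      by (rule iter_deriv_add_scaled[OF o Ck_on_mono[OF Ck[OF c] vs] Ck_on_mono[OF Ck[OF f] vs]])
        (use that K(2) in auto)
    obtain M where M: "M < \<epsilon>" "\<And>x. x \<in> K \<Longrightarrow> \<bar>?D c x - ?D h x\<bar> \<le> M"
    proof (cases "K = {}")
      case True
      then show ?thesis using that[of 0] \<epsilon> by auto
    next
      case False
      have "continuous_on K (\<lambda>x. \<bar>?D c x - ?D h x\<bar>)"
        by (intro continuous_on_rabs continuous_on_diff cont c h)
      then obtain x where "x \<in> K" "\<And>y. y \<in> K \<Longrightarrow> \<bar>?D c y - ?D h y\<bar> \<le> \<bar>?D c x - ?D h x\<bar>"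
        using continuous_attains_sup[OF K(1) False] by blast
      moreover have "\<bar>?D c x - ?D h x\<bar> < \<epsilon>"
        using Basis(2) \<open>x \<in> K\<close> unfolding T Ck_nbhd_def by auto
      ultimately show ?thesis by (intro that)
    qed
    have "bounded (?D f ` K)"
      by (rule compact_imp_bounded[OF compact_continuous_image[OF cont[OF f] K(1)]])
    then obtain B where B: "B > 0" "\<And>x. x \<in> K \<Longrightarrow> \<bar>?D f x\<bar> \<le> B"
      unfolding bounded_pos by auto
    show ?case
    proof (intro exI[of _ "(\<epsilon> - M) / B"] conjI allI impI)
      show "(\<epsilon> - M) / B > 0" using M(1) B(1) by simp
      fix t :: real assume t: "\<bar>t\<bar> < (\<epsilon> - M) / B"
      have "\<bar>?D (\<lambda>z. c z + t * f z) x - ?D h x\<bar> < \<epsilon>" if x: "x \<in> K" for x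
      proof -
        have "\<bar>t * ?D f x\<bar> \<le> \<bar>t\<bar> * B"
          unfolding abs_mult by (rule mult_left_mono[OF B(2)[OF x]]) simp
        also have "\<dots> < \<epsilon> - M" using t B(1) by (simp add: pos_less_divide_eq)
        finally show ?thesis unfolding lin[OF x] using M(2)[OF x] by linarith
      qed
      then show "(\<lambda>z. c z + t * f z) \<in> T"
        unfolding T Ck_nbhd_def using Ck_functions_add_scaled[OF c f] by auto
    qed
  qed simp
  then show ?thesis using that by blast
qed

end

text \<open>
  Rectangles of chart balls form a base of the product and are exhausted by products of bump
  functions.
\<close>

lemma countable_smooth_separating_family:
  fixes A :: "('a::{t2_space, second_countable_topology}, 'e::euclidean_space) chart set"
    and B :: "('b::{t2_space, second_countable_topology}, 'f::euclidean_space) chart set"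
  assumes A: "smooth_atlas A" and B: "smooth_atlas B"
  obtains F where "countable F" "F \<subseteq> Ck_functions (prod_atlas A B) \<infinity>"
    "\<And>M N. prob_space M \<Longrightarrow> prob_space N \<Longrightarrow> sets M = sets borel \<Longrightarrow> sets N = sets borel \<Longrightarrow>
       (\<And>f. f \<in> F \<Longrightarrow> (\<integral>x. f x \<partial>M) = (\<integral>x. f x \<partial>N)) \<Longrightarrow> M = N"
proof -
  let ?X = "prod_atlas A B"
  note X_charts = prod_atlas_charts[OF A B]
  interpret smooth: chart_cover ?X \<infinity> by (rule chart_cover.intro) (fact X_charts)+
  have base: "\<exists>W g. open W \<and> z \<in> W \<and> W \<subseteq> G \<and> exhausts g W \<and> (\<forall>n. g n \<in> Ck_functions ?X \<infinity>)"
    if G: "open G" "z \<in> G" for G and z :: "'a \<times> 'b"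
  proof -
    obtain U V where UV: "open U" "open V" "z \<in> U \<times> V" "U \<times> V \<subseteq> G"
      by (rule open_prod_elim[OF G])
    have "fst z \<in> U" "snd z \<in> V" using UV(3) by auto
    obtain W g where W: "open W" "fst z \<in> W" "W \<subseteq> U" "exhausts g W" "\<And>n. g n \<in> Ck_functions A \<infinity>"
      using smooth_exhaustible_base[OF A UV(1) \<open>fst z \<in> U\<close>] by metis
    obtain W' g' where W': "open W'" "snd z \<in> W'" "W' \<subseteq> V" "exhausts g' W'" "\<And>n. g' n \<in> Ck_functions B \<infinity>"
      using smooth_exhaustible_base[OF B UV(2) \<open>snd z \<in> V\<close>] by metis
    have "open (W \<times> W')" using W W' by (intro open_Times)
    moreover have "z \<in> W \<times> W'" "W \<times> W' \<subseteq> G" using W W' UV(4) by (auto simp: mem_Times_iff)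
    moreover have "exhausts (\<lambda>n (x, y). g n x * g' n y) (W \<times> W')" by (rule exhausts_Times[OF W(4) W'(4)])
    moreover have "\<forall>n. (\<lambda>(x, y). g n x * g' n y) \<in> Ck_functions ?X \<infinity>"
      using Ck_functions_times[OF A B W(5) W'(5)] by blast
    ultimately show ?thesis
      by (intro exI[of _ "W \<times> W'"] exI[of _ "\<lambda>n (x, y). g n x * g' n y"] conjI)
  qed
  show thesis
  proof (rule countable_separating_family[of "Ck_functions ?X \<infinity>"])
    show "(\<lambda>z. f z * g z) \<in> Ck_functions ?X \<infinity>"
      if "f \<in> Ck_functions ?X \<infinity>" "g \<in> Ck_functions ?X \<infinity>" for f g
      by (rule Ck_functions_mult) (fact X_charts(1) that)+
    show "(\<lambda>z. 1) \<in> Ck_functions ?X \<infinity>" by (rule Ck_functions_const) (fact X_charts(1))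
    show "\<exists>W g. open W \<and> z \<in> W \<and> W \<subseteq> G \<and> exhausts g W \<and> (\<forall>n. g n \<in> Ck_functions ?X \<infinity>)"
      if "open G" "z \<in> G" for G z
      by (rule base[OF that])
    show "continuous_on UNIV f" if "f \<in> Ck_functions ?X \<infinity>" for f
      by (rule smooth.Ck_functions_continuous[OF that])
    fix F
    assume F: "countable F" "F \<subseteq> Ck_functions ?X \<infinity>"
    "\<And>M N. prob_space M \<Longrightarrow> prob_space N \<Longrightarrow> sets M = sets borel \<Longrightarrow> sets N = sets borel \<Longrightarrow>
       (\<And>f. f \<in> F \<Longrightarrow> (\<integral>x. f x \<partial>M) = (\<integral>x. f x \<partial>N)) \<Longrightarrow> M = N"
    show thesis by (rule that) (fact F)+
  qed
qed

section \<open>Generic uniqueness\<close>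

text \<open>
  If \<open>p\<close> is nearly minimal for \<open>C + t F\<close> and \<open>q\<close> for \<open>C + u F\<close> with \<open>t < u\<close>, adding the two
  inequalities shows that \<open>F q\<close> exceeds \<open>F p\<close> at most by a small amount. If there were a spread
  of \<open>r\<close> at every \<open>t\<close>, then along sufficiently many equidistant values of \<open>t\<close> the values of \<open>F\<close>
  would decrease below \<open>- B\<close>. This is the argument that a bounded monotone slope has few large jumps,
  in terms of difference quotients of the minimal value.
\<close>

lemma small_spread_on_line:
  fixes P :: "'p set" and C F :: "'p \<Rightarrow> real"
  assumes "\<And>p. p \<in> P \<Longrightarrow> \<bar>F p\<bar> \<le> B" "d > 0" "r > 0"
  obtains t e where "0 \<le> t" "t < d" "e > 0"
    "\<And>p q. p \<in> P \<Longrightarrow> q \<in> P \<Longrightarrow> (\<forall>s\<in>P. C p + t * F p \<le> C s + t * F s + e) \<Longrightarrow>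
       (\<forall>s\<in>P. C q + t * F q \<le> C s + t * F s + e) \<Longrightarrow> \<bar>F p - F q\<bar> < r"
proof (rule ccontr)
  assume no: "\<not> thesis"
  note witness = that
  let ?opt = "\<lambda>t e p. p \<in> P \<and> (\<forall>s\<in>P. C p + t * F p \<le> C s + t * F s + e)"
  have ex: "\<exists>p q. ?opt t e p \<and> ?opt t e q \<and> F q + r \<le> F p" if te: "0 \<le> t" "t < d" "e > 0" for t e
  proof -
    have "\<not> (\<forall>p q. ?opt t e p \<longrightarrow> ?opt t e q \<longrightarrow> \<bar>F p - F q\<bar> < r)"
      using no witness[OF te] by blast
    then obtain p q where pq: "?opt t e p" "?opt t e q" "r \<le> \<bar>F p - F q\<bar>" by (auto simp: not_less)
    show ?thesis
    proof (cases "F q \<le> F p")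
      case True
      then show ?thesis using pq by (intro exI[of _ p] exI[of _ q]) auto
    next
      case False
      then show ?thesis using pq by (intro exI[of _ q] exI[of _ p]) auto
    qed
  qed
  \<comment> \<open>\<open>N\<close> steps, each lowering \<open>F\<close> by \<open>r / 2\<close>, exceed the width \<open>2 * B\<close> of the range of \<open>F\<close>.\<close>
  obtain N :: nat where N: "4 * B < real N * r"
    using ex_less_of_nat_mult[OF assms(3)] by blast
  define gap where "gap = d / real (Suc N)"
  \<comment> \<open>The two near-optimality errors add up to \<open>2 * e\<close>, which is half of a jump by \<open>r\<close> across a gap.\<close>
  define e where "e = gap * r / 4"
  have gap: "gap > 0" using assms(2) by (simp add: gap_def)
  have e: "e > 0" using gap assms(3) by (simp add: e_def)
  have "real i * gap < d" if "i \<le> N" for i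
  proof -
    have "real i * d < real (Suc N) * d" using that assms(2) by (intro mult_strict_right_mono) auto
    then show ?thesis by (simp add: gap_def field_simps)
  qed
  then have "\<exists>p q. ?opt (real i * gap) e p \<and> ?opt (real i * gap) e q \<and> F q + r \<le> F p" if "i \<le> N" for i
    using that gap by (intro ex e) auto
  then obtain hi lo where hl: "\<And>i. i \<le> N \<Longrightarrow> ?opt (real i * gap) e (hi i)"
    "\<And>i. i \<le> N \<Longrightarrow> ?opt (real i * gap) e (lo i)" "\<And>i. i \<le> N \<Longrightarrow> F (lo i) + r \<le> F (hi i)"
    by metis
  have step: "F (hi (Suc i)) \<le> F (hi i) - r / 2" if i: "Suc i \<le> N" for i
  proof -
    let ?p = "lo i" and ?q = "hi (Suc i)"
    have "C ?p + real i * gap * F ?p \<le> C ?q + real i * gap * F ?q + e"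
      using hl(2)[of i] hl(1)[of "Suc i"] i by auto
    moreover have "C ?q + real (Suc i) * gap * F ?q \<le> C ?p + real (Suc i) * gap * F ?p + e"
      using hl(2)[of i] hl(1)[of "Suc i"] i by auto
    ultimately have "gap * (F ?q - F ?p) \<le> gap * (r / 2)"
      by (simp add: e_def algebra_simps)
    then have "F ?q - F ?p \<le> r / 2" using gap by simp
    then show ?thesis using hl(3)[of i] i by simp
  qed
  have "i \<le> N \<Longrightarrow> F (hi i) \<le> F (hi 0) - real i * (r / 2)" for i
  proof (induction i)
    case (Suc i)
    then have "F (hi (Suc i)) \<le> F (hi 0) - real i * (r / 2) - r / 2" using step[of i] by simp
    then show ?case by (simp add: algebra_simps add_divide_distrib)
  qed simp
  from this[of N] have "real N * r \<le> 2 * (F (hi 0) - F (hi N))" by simp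
  also have "\<dots> \<le> 4 * B" using assms(1)[of "hi 0"] assms(1)[of "hi N"] hl(1)[of 0] hl(1)[of N] by simp
  finally show False using N by simp
qed

context compact_marginals
begin

definition near_optimal :: "('a \<times> 'b \<Rightarrow> real) \<Rightarrow> real \<Rightarrow> ('a \<times> 'b) measure \<Rightarrow> bool" where
  "near_optimal c e \<gamma> \<longleftrightarrow> \<gamma> \<in> transport_plans \<mu> \<nu> \<and>
     (\<forall>\<eta>\<in>transport_plans \<mu> \<nu>. (\<integral>z. c z \<partial>\<gamma>) \<le> (\<integral>z. c z \<partial>\<eta>) + e)"

definition spread_less :: "('a \<times> 'b \<Rightarrow> real) \<Rightarrow> real \<Rightarrow> ('a \<times> 'b \<Rightarrow> real) \<Rightarrow> bool" where
  "spread_less f r c \<longleftrightarrow> (\<exists>e>0. \<forall>\<gamma> \<gamma>'. near_optimal c e \<gamma> \<longrightarrow> near_optimal c e \<gamma>' \<longrightarrow>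
     \<bar>(\<integral>z. f z \<partial>\<gamma>) - (\<integral>z. f z \<partial>\<gamma>')\<bar> < r)"

lemma integral_close:
  fixes g c :: "'a \<times> 'b \<Rightarrow> real"
  assumes "\<gamma> \<in> transport_plans \<mu> \<nu>" "continuous_on UNIV g" "continuous_on UNIV c"
    and "\<And>z. \<bar>g z - c z\<bar> \<le> \<delta>"
  shows "\<bar>(\<integral>z. g z \<partial>\<gamma>) - (\<integral>z. c z \<partial>\<gamma>)\<bar> \<le> \<delta>"
proof -
  interpret prob_space \<gamma> by (rule plan_prob_space[OF assms(1)])
  note int = plan_integrable_continuous[OF assms(1,2)] plan_integrable_continuous[OF assms(1,3)]
  have "\<bar>\<integral>z. g z - c z \<partial>\<gamma>\<bar> \<le> (\<integral>z. \<delta> \<partial>\<gamma>)"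
    by (rule order_trans[OF integral_abs_bound integral_mono]) (use assms(4) int in auto)
  then show ?thesis using Bochner_Integration.integral_diff[OF int] by (simp add: prob_space)
qed

text \<open>
  A change of the cost by less than \<open>e / 4\<close> changes each of the two integrals that are compared by at
  most \<open>e / 4\<close>, so plans that are optimal up to \<open>e / 2\<close> for the new cost are optimal up to \<open>e\<close> for
  the old one.
\<close>

lemma spread_less_stable:
  fixes c :: "'a \<times> 'b \<Rightarrow> real"
  assumes "spread_less f r c" "continuous_on UNIV c"
  obtains \<delta> where "\<delta> > 0"
    "\<And>g. continuous_on UNIV g \<Longrightarrow> (\<And>z. \<bar>g z - c z\<bar> < \<delta>) \<Longrightarrow> spread_less f r g"
proof -
  obtain e where e: "e > 0" "\<And>\<gamma> \<gamma>'. near_optimal c e \<gamma> \<Longrightarrow> near_optimal c e \<gamma>' \<Longrightarrow>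
      \<bar>(\<integral>z. f z \<partial>\<gamma>) - (\<integral>z. f z \<partial>\<gamma>')\<bar> < r"
    using assms(1) unfolding spread_less_def by blast
  show ?thesis
  proof (rule that[of "e / 4"])
    show "e / 4 > 0" using e by simp
    fix g :: "'a \<times> 'b \<Rightarrow> real" assume g: "continuous_on UNIV g" "\<And>z. \<bar>g z - c z\<bar> < e / 4"
    have close: "\<bar>(\<integral>z. g z \<partial>\<gamma>) - (\<integral>z. c z \<partial>\<gamma>)\<bar> \<le> e / 4" if "\<gamma> \<in> transport_plans \<mu> \<nu>" for \<gamma>
      using g(2) by (intro integral_close[OF that g(1) assms(2)] less_imp_le)
    have "near_optimal c e \<gamma>" if \<gamma>: "near_optimal g (e / 2) \<gamma>" for \<gamma>
      unfolding near_optimal_def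
    proof (intro conjI ballI)
      show 1: "\<gamma> \<in> transport_plans \<mu> \<nu>" using \<gamma> by (simp add: near_optimal_def)
      fix \<eta> assume 2: "\<eta> \<in> transport_plans \<mu> \<nu>"
      then have "(\<integral>z. g z \<partial>\<gamma>) \<le> (\<integral>z. g z \<partial>\<eta>) + e / 2" using \<gamma> by (simp add: near_optimal_def)
      then show "(\<integral>z. c z \<partial>\<gamma>) \<le> (\<integral>z. c z \<partial>\<eta>) + e" using close[OF 1] close[OF 2] by linarith
    qed
    then show "spread_less f r g" unfolding spread_less_def
      using e by (intro exI[of _ "e / 2"]) auto
  qed
qed

lemma spread_less_on_line:
  fixes c f :: "'a \<times> 'b \<Rightarrow> real"
  assumes "continuous_on UNIV c" "continuous_on UNIV f" "d > 0" "r > 0"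
  obtains t where "0 \<le> t" "t < d" "spread_less f r (\<lambda>z. c z + t * f z)"
proof -
  let ?P = "transport_plans \<mu> \<nu>"
  obtain B where "B > 0" "\<And>z. \<bar>f z\<bar> \<le> B" using continuous_bounded[OF assms(2)] by blast
  then have B: "\<bar>\<integral>z. f z \<partial>\<gamma>\<bar> \<le> B" if "\<gamma> \<in> ?P" for \<gamma>
    using integral_close[OF that assms(2) continuous_on_const[of _ 0], of B] by simp
  have eq: "(\<integral>z. c z + t * f z \<partial>\<gamma>) = (\<integral>z. c z \<partial>\<gamma>) + t * (\<integral>z. f z \<partial>\<gamma>)" if "\<gamma> \<in> ?P" for \<gamma> t
    using plan_integrable_continuous[OF that assms(1)] plan_integrable_continuous[OF that assms(2)] by simp
  show ?thesis
  proof (rule small_spread_on_line[of ?P "\<lambda>\<gamma>. \<integral>z. f z \<partial>\<gamma>" B d r "\<lambda>\<gamma>. \<integral>z. c z \<partial>\<gamma>"])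
    fix t e
    assume t: "0 \<le> t" "t < d" "e > 0"
      and te: "\<And>p q. p \<in> ?P \<Longrightarrow> q \<in> ?P \<Longrightarrow>
         (\<forall>s\<in>?P. (\<integral>z. c z \<partial>p) + t * (\<integral>z. f z \<partial>p) \<le> (\<integral>z. c z \<partial>s) + t * (\<integral>z. f z \<partial>s) + e) \<Longrightarrow>
         (\<forall>s\<in>?P. (\<integral>z. c z \<partial>q) + t * (\<integral>z. f z \<partial>q) \<le> (\<integral>z. c z \<partial>s) + t * (\<integral>z. f z \<partial>s) + e) \<Longrightarrow>
         \<bar>(\<integral>z. f z \<partial>p) - (\<integral>z. f z \<partial>q)\<bar> < r"
    have "spread_less f r (\<lambda>z. c z + t * f z)"
      unfolding spread_less_def near_optimal_def
    proof (intro exI[of _ e] conjI allI impI)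
      fix p q
      assume "p \<in> ?P \<and> (\<forall>\<eta>\<in>?P. (\<integral>z. c z + t * f z \<partial>p) \<le> (\<integral>z. c z + t * f z \<partial>\<eta>) + e)"
        "q \<in> ?P \<and> (\<forall>\<eta>\<in>?P. (\<integral>z. c z + t * f z \<partial>q) \<le> (\<integral>z. c z + t * f z \<partial>\<eta>) + e)"
      then show "\<bar>(\<integral>z. f z \<partial>p) - (\<integral>z. f z \<partial>q)\<bar> < r" by (intro te) (auto simp: eq)
    qed (rule t(3))
    then show thesis by (rule that[OF t(1,2)])
  qed (use B assms(3,4) in auto)
qed

end

theorem theorem1p8:
  fixes A :: "('a::{t2_space, second_countable_topology}, 'e::euclidean_space) chart set"
    and B :: "('b::{t2_space, second_countable_topology}, 'f::euclidean_space) chart set"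
    and \<mu> :: "'a measure" and \<nu> :: "'b measure"
    and k :: enat
  assumes "smooth_closed_manifold A" and "smooth_closed_manifold B"
    and "prob_space \<mu>" and "sets \<mu> = sets borel"
    and "prob_space \<nu>" and "sets \<nu> = sets borel"
  shows "\<exists>\<C>. residual_in (Ck_topology (prod_atlas A B) k) \<C> \<and>
           (\<forall>c\<in>\<C>. \<exists>!\<gamma>. optimal_plan c \<mu> \<nu> \<gamma>)"
proof -
  have A: "smooth_atlas A" "compact (UNIV :: 'a set)" and B: "smooth_atlas B" "compact (UNIV :: 'b set)"
    using assms(1,2) by (auto simp: smooth_closed_manifold_def)
  interpret compact_marginals \<mu> \<nu> using A(2) B(2) assms(3-6) by (rule compact_marginals.intro)
  let ?X = "prod_atlas A B"
  note X_charts = prod_atlas_charts[OF A(1) B(1)]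
  interpret chart_cover ?X k by (rule chart_cover.intro) (fact X_charts)+
  let ?T = "Ck_topology ?X k"
  have top: "topspace ?T = Ck_functions ?X k" by (rule topspace_Ck_topology[OF A_nonempty])
  obtain F where F: "countable F" "F \<subseteq> Ck_functions ?X \<infinity>"
    "\<And>M N. prob_space M \<Longrightarrow> prob_space N \<Longrightarrow> sets M = sets borel \<Longrightarrow> sets N = sets borel \<Longrightarrow>
       (\<And>f. f \<in> F \<Longrightarrow> (\<integral>x. f x \<partial>M) = (\<integral>x. f x \<partial>N)) \<Longrightarrow> M = N"
    by (rule countable_smooth_separating_family[OF A(1) B(1)]) blast
  \<comment> \<open>The residual set is the intersection of these sets over \<open>f \<in> F\<close> and \<open>n\<close>.\<close>
  define S where "S f n = {c \<in> Ck_functions ?X k. spread_less f (1 / real (Suc n)) c}" for f n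
  have open_S: "openin ?T (S f n)" for f n
  proof (subst openin_subopen, intro ballI)
    fix c assume "c \<in> S f n"
    then have c: "c \<in> Ck_functions ?X k" "spread_less f (1 / real (Suc n)) c" by (auto simp: S_def)
    obtain \<delta> where \<delta>: "\<delta> > 0" "\<And>g. continuous_on UNIV g \<Longrightarrow> (\<And>z. \<bar>g z - c z\<bar> < \<delta>) \<Longrightarrow>
        spread_less f (1 / real (Suc n)) g"
      using spread_less_stable[OF c(2) Ck_functions_continuous[OF c(1)]] by blast
    obtain U where U: "openin ?T U" "c \<in> U" "\<And>g z. g \<in> U \<Longrightarrow> \<bar>g z - c z\<bar> < \<delta>"
      using Ck_topology_sup_nbhd[OF compact_prod c(1) \<delta>(1)] by blast
    have "U \<subseteq> S f n"
    proof
      fix g assume g: "g \<in> U"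
      then have "g \<in> Ck_functions ?X k" using openin_subset[OF U(1)] top by auto
      then show "g \<in> S f n" using \<delta>(2) U(3)[OF g] Ck_functions_continuous by (simp add: S_def)
    qed
    then show "\<exists>U. openin ?T U \<and> c \<in> U \<and> U \<subseteq> S f n" using U by blast
  qed
  have dense_S: "?T closure_of S f n = topspace ?T" if "f \<in> F" for f n
  proof (rule equalityI[OF closure_of_subset_topspace], rule subsetI)
    fix c assume "c \<in> topspace ?T"
    then have c: "c \<in> Ck_functions ?X k" using top by simp
    have f: "f \<in> Ck_functions ?X k" using that F(2) Ck_functions_mono[of f ?X \<infinity> k] by auto
    have r: "1 / real (Suc n) > 0" by simp
    have "\<exists>g. g \<in> S f n \<and> g \<in> U" if U: "openin ?T U" "c \<in> U" for U
    proof -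
      obtain d where d: "d > 0" "\<And>t. \<bar>t\<bar> < d \<Longrightarrow> (\<lambda>z. c z + t * f z) \<in> U"
        using Ck_topology_line[OF f c U] by blast
      obtain t where t: "0 \<le> t" "t < d" "spread_less f (1 / real (Suc n)) (\<lambda>z. c z + t * f z)"
        using spread_less_on_line[OF Ck_functions_continuous[OF c] Ck_functions_continuous[OF f] d(1) r] by blast
      then show ?thesis
        using d(2)[of t] Ck_functions_add_scaled[OF c f] by (intro exI[of _ "\<lambda>z. c z + t * f z"]) (simp add: S_def)
    qed
    then show "c \<in> ?T closure_of S f n" using \<open>c \<in> topspace ?T\<close> by (auto simp: in_closure_of)
  qed
  let ?\<U> = "(\<lambda>(f, n). S f n) ` (F \<times> (UNIV :: nat set))"
  show ?thesis
  proof (intro exI[of _ "topspace ?T \<inter> \<Inter>?\<U>"] conjI ballI)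
    show "residual_in ?T (topspace ?T \<inter> \<Inter>?\<U>)"
      unfolding residual_in_def
    proof (intro exI[of _ ?\<U>] conjI ballI)
      show "countable ?\<U>" using F(1) by (intro countable_image countable_SIGMA) auto
    qed (use open_S dense_S in auto)
    fix c assume c: "c \<in> topspace ?T \<inter> \<Inter>?\<U>"
    then have cont: "continuous_on UNIV c" using top Ck_functions_continuous by auto
    have near: "near_optimal c e \<gamma>" if "optimal_plan c \<mu> \<nu> \<gamma>" "e > 0" for \<gamma> e
      using that unfolding optimal_plan_def near_optimal_def by force
    show "\<exists>!\<gamma>. optimal_plan c \<mu> \<nu> \<gamma>"
    proof (rule ex_ex1I)
      show "\<exists>\<gamma>. optimal_plan c \<mu> \<nu> \<gamma>" using optimal_plan_exists[OF cont] by blast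
      fix \<gamma> \<gamma>' assume opt: "optimal_plan c \<mu> \<nu> \<gamma>" "optimal_plan c \<mu> \<nu> \<gamma>'"
      then have P: "\<gamma> \<in> transport_plans \<mu> \<nu>" "\<gamma>' \<in> transport_plans \<mu> \<nu>" by (auto simp: optimal_plan_def)
      show "\<gamma> = \<gamma>'"
      proof (rule F(3))
        fix f assume f: "f \<in> F"
        have lt: "\<bar>(\<integral>z. f z \<partial>\<gamma>) - (\<integral>z. f z \<partial>\<gamma>')\<bar> < 1 / real (Suc n)" for n
        proof -
          have "c \<in> S f n" using c f by auto
          then obtain e where "e > 0" "\<And>\<gamma> \<gamma>'. near_optimal c e \<gamma> \<Longrightarrow> near_optimal c e \<gamma>' \<Longrightarrow>
              \<bar>(\<integral>z. f z \<partial>\<gamma>) - (\<integral>z. f z \<partial>\<gamma>')\<bar> < 1 / real (Suc n)"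
            unfolding S_def spread_less_def by auto
          then show ?thesis using near opt by blast
        qed
        show "(\<integral>z. f z \<partial>\<gamma>) = (\<integral>z. f z \<partial>\<gamma>')"
        proof (rule ccontr)
          assume "(\<integral>z. f z \<partial>\<gamma>) \<noteq> (\<integral>z. f z \<partial>\<gamma>')"
          then obtain n where "1 / real (Suc n) < \<bar>(\<integral>z. f z \<partial>\<gamma>) - (\<integral>z. f z \<partial>\<gamma>')\<bar>"
            using reals_Archimedean[of "\<bar>(\<integral>z. f z \<partial>\<gamma>) - (\<integral>z. f z \<partial>\<gamma>')\<bar>"] by (auto simp: inverse_eq_divide)
          then show False using lt[of n] by linarith
        qed
      qed (use P plan_prob_space plan_sets in auto)
    qed
  qed
qed

end
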